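(* Let $S\subset\mathbb{R}^2$ be a compact set such that $\partial S$ is path-connected and $S=\overline{\mathrm{int}(S)}$. Let $\mathcal{X}_n$ be any set of $n$ points in $S$ (not necessarily random). Then for all $\theta\in[0,\pi/2)$, for all $n$ and for all $c>\sqrt{2}$, $$d_H(\mathbb{B}_\theta(\mathcal{X}_n),\mathbb{B}_\theta(S))\leq c\,d_H(S,\mathcal{X}_n),$$ $$d_H(\partial\mathbb{B}_\theta(S),\partial\mathbb{B}_\theta(\mathcal{X}_n))\leq c\,d_H(S,\mathcal{X}_n).$$ If for all $\theta$ there exists the Minkowski content $L_0=L_0(\theta)$ of $\partial\mathbb{B}_\theta(S)$, then, for $n$ large enough, $$d_\mu(\mathbb{B}_\theta(\mathcal{X}_n),\mathbb{B}_\theta(S))\leq 2c\,L_0(\theta)\,d_H(S,\mathcal{X}_n).$$ In particular, if, for every $n\in\mathbb{N}$, $\mathcal{X}_n$ denotes a random sample from a distribution $P_X$ with a $\theta$-biconvex support $S$, these three inequalities provide almost sure consistency results for the estimation of $S$ by $\mathbb{B}_\theta(\mathcal{X}_n)$ (with respect to $d_H$ and $d_\mu$) and of $\partial S$ by $\partial\mathbb{B}_\theta(\mathcal{X}_n)$ (with respect to $d_H$); that is, the corresponding distances tend to $0$ almost surely as $n\to\infty$.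
   Context: $\mathbb{R}^2$ carries the Euclidean norm $\|\cdot\|$ and inner product $\langle\cdot,\cdot\rangle$; $\partial$, $\mathrm{int}$, overline and superscript $c$ denote boundary, interior, closure and complement; $\mu$ is Lebesgue measure on $\mathbb{R}^2$. A random sample from $P_X$ is a set $\{X_1,\dots,X_n\}$ of independent identically distributed points drawn from $P_X$; the support of a distribution is the smallest closed set of probability one. For $\theta\in[0,\pi/2)$ put $b_1=(\cos\theta,\sin\theta)$, $b_2=(-\sin\theta,\cos\theta)$, $\xi=(b_1+b_2)/\|b_1+b_2\|$. A set $S$ is $\theta$-biconvex if for all $\alpha,\beta\in\mathbb{R}$ the sets $\{\alpha b_1+tb_2:t\in\mathbb{R}\}\cap S$ and $\{tb_1+\beta b_2:t\in\mathbb{R}\}\cap S$ are convex (possibly empty). Let $R$ be the counter-clockwise rotation of angle $\pi/2$ about the origin, $R^0(\xi)=\xi$, $R^i(\xi)=R(R^{i-1}(\xi))$ for $i=1,2,3$. For a unit vector $v$ and $x\in\mathbb{R}^2$, $C_v(x)=\{z\neq x:\langle v,(z-x)/\|z-x\|\rangle>\cos(\pi/4)\}$ (open quadrant with vertex $x$ and axis $v$). The $\theta$-biconvex hull of $A\subset\mathbb{R}^2$ is $$\mathbb{B}_\theta(A)=\bigcap\big\{(C_{R^i(\xi)}(y))^c:\ i\in\{0,1,2,3\},\ y\in\mathbb{R}^2,\ C_{R^i(\xi)}(y)\cap A=\emptyset\big\}.$$ For non-empty compact $A,C$: $d_H(A,C)=\max\{\max_{a\in A}d(a,C),\max_{c\in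 C}d(c,A)\}$, with $d(x,A)=\inf_{a\in A}\|x-a\|$; and $d_\mu(A,C)=\mu(A\triangle C)$, where $\triangle$ is the symmetric difference. Minkowski content: writing $B(T,\epsilon)=\bigcup_{t\in T}B(t,\epsilon)$ for the union of closed balls of radius $\epsilon$ centred in $T$, $L_0(\theta)=\lim_{\epsilon\to0}\mu(B(\partial\mathbb{B}_\theta(S),\epsilon))/(2\epsilon)$, provided the limit exists and is finite. *)

theory Defs
  imports "HOL-Analysis.Analysis" "HOL-Probability.Probability"
begin

definition b1 :: "real \<Rightarrow> real^2" where
  "b1 \<theta> = vector [cos \<theta>, sin \<theta>]"

definition b2 :: "real \<Rightarrow> real^2" where
  "b2 \<theta> = vector [- sin \<theta>, cos \<theta>]"

definition axis_dir :: "real \<Rightarrow> real^2" where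
  "axis_dir \<theta> = (b1 \<theta> + b2 \<theta>) /\<^sub>R norm (b1 \<theta> + b2 \<theta>)"

definition biconvex :: "real \<Rightarrow> (real^2) set \<Rightarrow> bool" where
  "biconvex \<theta> S \<longleftrightarrow>
     (\<forall>\<alpha> \<beta>. convex (range (\<lambda>t. \<alpha> *\<^sub>R b1 \<theta> + t *\<^sub>R b2 \<theta>) \<inter> S) \<and>
            convex (range (\<lambda>t. t *\<^sub>R b1 \<theta> + \<beta> *\<^sub>R b2 \<theta>) \<inter> S))"

text \<open>Counter-clockwise rotation of angle \<^term>\<open>pi / 2\<close> about the origin.\<close>

definition rot :: "real^2 \<Rightarrow> real^2" where
  "rot x = vector [- (x $ 2), x $ 1]"

text \<open>An open quadrant only for unit vectors \<open>v\<close>: half-opening angle \<^term>\<open>pi / 4\<close> around \<open>v\<close>.\<close>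

definition quadrant :: "real^2 \<Rightarrow> real^2 \<Rightarrow> (real^2) set" where
  "quadrant v x = {z. z \<noteq> x \<and> v \<bullet> ((z - x) /\<^sub>R norm (z - x)) > cos (pi / 4)}"

definition biconvex_hull :: "real \<Rightarrow> (real^2) set \<Rightarrow> (real^2) set" where
  "biconvex_hull \<theta> A =
     \<Inter> {- quadrant ((rot ^^ i) (axis_dir \<theta>)) y | i y.
          i \<in> {0..3} \<and> quadrant ((rot ^^ i) (axis_dir \<theta>)) y \<inter> A = {}}"

text \<open>Intended for non-empty compact arguments only. The two suprema are then maxima, since
  \<^term>\<open>\<lambda>x. infdist x C\<close> is continuous.\<close>

definition hausdorff_dist :: "(real^2) set \<Rightarrow> (real^2) set \<Rightarrow> real" where
  "hausdorff_dist A C = max (SUP a\<in>A. infdist a C) (SUP c\<in>C. infdist c A)"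

definition measure_dist :: "(real^2) set \<Rightarrow> (real^2) set \<Rightarrow> real" where
  "measure_dist A C = measure lebesgue (sym_diff A C)"

text \<open>The Minkowski content of \<open>T\<close> exists, is finite, and equals \<open>L\<close>.\<close>

definition has_minkowski_content :: "(real^2) set \<Rightarrow> real \<Rightarrow> bool" where
  "has_minkowski_content T L \<longleftrightarrow>
     ((\<lambda>\<epsilon>. measure lebesgue (\<Union>t\<in>T. cball t \<epsilon>) / (2 * \<epsilon>)) \<longlongrightarrow> L) (at_right 0)"

text \<open>\<open>S\<close> is the smallest closed set of probability one.\<close>

definition is_support :: "(real^2) measure \<Rightarrow> (real^2) set \<Rightarrow> bool" where
  "is_support P S \<longleftrightarrow>
     closed S \<and> measure P S = 1 \<and> (\<forall>F. closed F \<and> measure P F = 1 \<longrightarrow> S \<subseteq> F)"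

definition iid_sample ::
  "'w measure \<Rightarrow> (real^2) measure \<Rightarrow> nat \<Rightarrow> (nat \<Rightarrow> 'w \<Rightarrow> real^2) \<Rightarrow> bool" where
  "iid_sample M P n Y \<longleftrightarrow>
     prob_space.indep_vars M (\<lambda>_. borel) Y {1..n} \<and> (\<forall>i\<in>{1..n}. distr M borel (Y i) = P)"

text \<open>Atoms of the distribution are allowed, so this set may have fewer than \<open>n\<close> elements.\<close>

definition sample_set :: "nat \<Rightarrow> (nat \<Rightarrow> 'w \<Rightarrow> real^2) \<Rightarrow> 'w \<Rightarrow> (real^2) set" where
  "sample_set n Y \<omega> = (\<lambda>i. Y i \<omega>) ` {1..n}"

end

theory Submission
  imports Defs
begin

text \<open>In the coordinates along \<open>b1 \<theta>\<close> and \<open>b2 \<theta>\<close> the hull of a compact set \<open>A\<close> consists of the points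
  all four closed quadrants of which meet \<open>A\<close>. Let \<open>e\<close> be the Hausdorff distance of \<open>S\<close> and \<open>X\<close>.
  As \<open>S\<close> is connected, the vertical and the horizontal strip of half-width \<open>e\<close> around a point \<open>p\<close>
  of the hull of \<open>S\<close> both contain points of \<open>X\<close>; recombining their coordinates with those of a third
  point of \<open>X\<close> yields a point of the hull of \<open>X\<close> at coordinatewise distance at most \<open>e\<close>, hence the
  factor \<open>sqrt 2\<close>. Conversely, shifting a quadrant free of \<open>X\<close> by \<open>e\<close> in both coordinates makes it
  free of \<open>S\<close>. So the hull of \<open>X\<close> contains the erosion of the hull \<open>K\<close> of \<open>S\<close> by a square of half-width
  \<open>e\<close>. Eroding in one direction costs at most \<open>2 * e\<close> times the measure of the lines meeting \<open>K\<close> in a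
  nondegenerate segment, and by Fubini that measure is at most half the Minkowski content of the
  frontier. The area bound thus holds for every \<open>n\<close>, without \<open>e\<close> being small. Almost sure
  convergence follows from the Borel-Cantelli lemma, applied to a finite cover of \<open>S\<close> by balls.\<close>

subsection \<open>Quadrants and the hull in rotated coordinates\<close>

lemma inner_b_b [simp]: "b1 \<theta> \<bullet> b1 \<theta> = 1" "b1 \<theta> \<bullet> b2 \<theta> = 0" "b2 \<theta> \<bullet> b1 \<theta> = 0" "b2 \<theta> \<bullet> b2 \<theta> = 1"
  by (simp_all add: b1_def b2_def inner_vec_def UNIV_2 flip: power2_eq_square)

lemma frame_expansion: "p = (b1 \<theta> \<bullet> p) *\<^sub>R b1 \<theta> + (b2 \<theta> \<bullet> p) *\<^sub>R b2 \<theta>"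
proof -
  have trig: "cos \<theta> * (cos \<theta> * a) + sin \<theta> * (sin \<theta> * a) = a" for a
  proof -
    have "cos \<theta> * (cos \<theta> * a) + sin \<theta> * (sin \<theta> * a) = ((cos \<theta>)\<^sup>2 + (sin \<theta>)\<^sup>2) * a"
      by (simp only: power2_eq_square distrib_right mult.assoc)
    then show ?thesis by simp
  qed
  show ?thesis
    by (simp add: vec_eq_iff forall_2 b1_def b2_def inner_vec_def UNIV_2 algebra_simps trig)
qed

lemma inner_b1_frame [simp]: "b1 \<theta> \<bullet> (s *\<^sub>R b1 \<theta> + t *\<^sub>R b2 \<theta>) = s"
  and inner_b2_frame [simp]: "b2 \<theta> \<bullet> (s *\<^sub>R b1 \<theta> + t *\<^sub>R b2 \<theta>) = t"
  by (simp_all add: inner_add_right)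

lemma norm_eq_frame: "(norm p)\<^sup>2 = (b1 \<theta> \<bullet> p)\<^sup>2 + (b2 \<theta> \<bullet> p)\<^sup>2"
proof -
  have "p \<bullet> p = (b1 \<theta> \<bullet> p) * (p \<bullet> b1 \<theta>) + (b2 \<theta> \<bullet> p) * (p \<bullet> b2 \<theta>)"
    by (subst (2) frame_expansion[of p \<theta>]) (simp add: inner_add_right)
  then show ?thesis
    by (simp add: power2_norm_eq_inner inner_commute flip: power2_eq_square)
qed

lemma abs_inner_b_le: "\<bar>b1 \<theta> \<bullet> p\<bar> \<le> norm p" "\<bar>b2 \<theta> \<bullet> p\<bar> \<le> norm p"
  using Cauchy_Schwarz_ineq2[of "b1 \<theta>" p] Cauchy_Schwarz_ineq2[of "b2 \<theta>" p]
  by (simp_all add: norm_eq_sqrt_inner)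

text \<open>A square of half-width \<open>e\<close> lies in the disc of radius
  \<open>sqrt 2 * e\<close> about its centre. The factor \<open>sqrt 2\<close> in both Hausdorff
  bounds enters here, when coordinatewise estimates are turned into Euclidean ones.\<close>

lemma norm_le_sqrt2:
  assumes "\<bar>b1 \<theta> \<bullet> p\<bar> \<le> e" "\<bar>b2 \<theta> \<bullet> p\<bar> \<le> e"
  shows "norm p \<le> sqrt 2 * e"
proof (rule power2_le_imp_le)
  have e: "0 \<le> e" using assms by linarith
  have "(b1 \<theta> \<bullet> p)\<^sup>2 \<le> e\<^sup>2" "(b2 \<theta> \<bullet> p)\<^sup>2 \<le> e\<^sup>2"
    using assms by (metis abs_ge_zero power2_abs power_mono)+
  then show "(norm p)\<^sup>2 \<le> (sqrt 2 * e)\<^sup>2"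
    by (simp add: norm_eq_frame[of p \<theta>] power_mult_distrib)
  show "0 \<le> sqrt 2 * e" using e by simp
qed

lemma rot_frame: "rot (s *\<^sub>R b1 \<theta> + t *\<^sub>R b2 \<theta>) = (-t) *\<^sub>R b1 \<theta> + s *\<^sub>R b2 \<theta>"
  by (simp add: rot_def b1_def b2_def vec_eq_iff forall_2)

lemma axis_dir_eq: "axis_dir \<theta> = (1 / sqrt 2) *\<^sub>R b1 \<theta> + (1 / sqrt 2) *\<^sub>R b2 \<theta>"
proof -
  have "(norm (b1 \<theta> + b2 \<theta>))\<^sup>2 = 2"
    by (simp add: norm_eq_frame[of _ \<theta>] inner_add_right)
  then have "norm (b1 \<theta> + b2 \<theta>) = sqrt 2"
    by (metis norm_ge_zero real_sqrt_unique)
  then show ?thesis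
    by (simp add: axis_dir_def scaleR_add_right divide_inverse)
qed

text \<open>With \<open>a\<close>, \<open>b\<close> the coordinates of \<open>z - y\<close> oriented
  by the signs, the angle condition reads \<open>norm (z - y) < a + b\<close>. Since the squared
  norm is the sum of the squares of \<open>a\<close> and \<open>b\<close>, squaring leaves
  \<open>0 < a * b\<close>, and the positive sum makes both factors positive.\<close>

lemma quadrant_frame_eq:
  assumes "\<sigma> \<in> {1, -1}" "\<tau> \<in> {1, -1::real}"
  shows "quadrant ((\<sigma> / sqrt 2) *\<^sub>R b1 \<theta> + (\<tau> / sqrt 2) *\<^sub>R b2 \<theta>) y
    = {z. 0 < \<sigma> * (b1 \<theta> \<bullet> (z - y)) \<and> 0 < \<tau> * (b2 \<theta> \<bullet> (z - y))}" (is "?L = ?R")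
proof (rule set_eqI)
  fix z
  define a b where "a = \<sigma> * (b1 \<theta> \<bullet> (z - y))" and "b = \<tau> * (b2 \<theta> \<bullet> (z - y))"
  have s: "\<sigma> * \<sigma> = 1" "\<tau> * \<tau> = 1" using assms by auto
  have n: "(norm (z - y))\<^sup>2 = a\<^sup>2 + b\<^sup>2"
    using assms by (auto simp: a_def b_def norm_eq_frame[of _ \<theta>] power_mult_distrib)
  have ip: "((\<sigma> / sqrt 2) *\<^sub>R b1 \<theta> + (\<tau> / sqrt 2) *\<^sub>R b2 \<theta>) \<bullet> ((z - y) /\<^sub>R norm (z - y))
     = (a + b) / sqrt 2 / norm (z - y)"
    by (simp add: inner_add_left a_def b_def divide_simps)
  have cos: "cos (pi/4) = 1 / sqrt 2"
    by (simp add: cos_45 field_simps)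
  have "z \<in> ?L \<longleftrightarrow> z \<noteq> y \<and> norm (z - y) < a + b"
  proof (cases "z = y")
    case False
    then have "0 < norm (z - y)" by simp
    then show ?thesis
      unfolding quadrant_def mem_Collect_eq ip cos
      by (simp add: pos_less_divide_eq divide_less_cancel mult.commute False flip: divide_divide_eq_left)
  qed (simp add: quadrant_def)
  also have "\<dots> \<longleftrightarrow> 0 < a \<and> 0 < b"
  proof
    assume *: "z \<noteq> y \<and> norm (z - y) < a + b"
    then have ab: "(norm (z - y))\<^sup>2 < (a + b)\<^sup>2"
      by (intro power_strict_mono) auto
    then have "0 < a * b"
      using n by (simp add: power2_eq_square algebra_simps)
    moreover have "0 < a + b" using * norm_ge_zero[of "z - y"] by linarith
    ultimately show "0 < a \<and> 0 < b"
      by (smt (verit) zero_less_mult_iff)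
  next
    assume *: "0 < a \<and> 0 < b"
    then have "0 < a * b" by simp
    then have "(norm (z - y))\<^sup>2 < (a + b)\<^sup>2"
      using n by (simp add: power2_eq_square algebra_simps)
    then have "norm (z - y) < a + b"
      using * by (intro power_less_imp_less_base[of _ 2 "a + b"]) auto
    moreover have "z \<noteq> y" using * by (auto simp: a_def)
    ultimately show "z \<noteq> y \<and> norm (z - y) < a + b" by simp
  qed
  finally show "z \<in> ?L \<longleftrightarrow> z \<in> ?R" by (simp add: a_def b_def)
qed

text \<open>Each rotation sends the sign pair (\<sigma>, \<tau>) to (-\<tau>, \<sigma>), so the
  orbit of (1, 1) runs through all four pairs. From here on signs replace powers of
  \<open>rot\<close> as the index of the quadrants.\<close>

lemma quadrant_dirs:
  "(\<lambda>i. (rot ^^ i) (axis_dir \<theta>)) ` {0..3}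
    = {(\<sigma> / sqrt 2) *\<^sub>R b1 \<theta> + (\<tau> / sqrt 2) *\<^sub>R b2 \<theta> | \<sigma> \<tau>. \<sigma> \<in> {1,-1} \<and> \<tau> \<in> {1,-1}}"
proof -
  define f where "f \<sigma> \<tau> = (\<sigma> / sqrt 2) *\<^sub>R b1 \<theta> + (\<tau> / sqrt 2) *\<^sub>R b2 \<theta>" for \<sigma> \<tau> :: real
  have rot: "rot (f \<sigma> \<tau>) = f (-\<tau>) \<sigma>" for \<sigma> \<tau>
    unfolding f_def rot_frame by simp
  have axis: "axis_dir \<theta> = f 1 1"
    by (simp add: f_def axis_dir_eq)
  have "{0..3::nat} = {0, Suc 0, Suc (Suc 0), Suc (Suc (Suc 0))}" by auto
  then have "(\<lambda>i. (rot ^^ i) (axis_dir \<theta>)) ` {0..3} = {f 1 1, f (-1) 1, f (-1) (-1), f 1 (-1)}"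
    by (simp add: axis rot)
  also have "\<dots> = {f \<sigma> \<tau> | \<sigma> \<tau>. \<sigma> \<in> {1,-1} \<and> \<tau> \<in> {1,-1}}"
    by blast
  finally show ?thesis by (simp add: f_def)
qed

lemma mem_biconvex_hull_iff_open_quadrants:
  "p \<in> biconvex_hull \<theta> A \<longleftrightarrow>
    (\<forall>\<sigma>\<in>{1,-1}. \<forall>\<tau>\<in>{1,-1}. \<forall>y. 0 < \<sigma> * (b1 \<theta> \<bullet> (p - y)) \<and> 0 < \<tau> * (b2 \<theta> \<bullet> (p - y)) \<longrightarrow>
       (\<exists>z\<in>A. 0 < \<sigma> * (b1 \<theta> \<bullet> (z - y)) \<and> 0 < \<tau> * (b2 \<theta> \<bullet> (z - y))))"
proof -
  let ?V = "(\<lambda>i. (rot ^^ i) (axis_dir \<theta>)) ` {0..3}"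
  have "p \<in> biconvex_hull \<theta> A \<longleftrightarrow> (\<forall>v\<in>?V. \<forall>y. p \<in> quadrant v y \<longrightarrow> quadrant v y \<inter> A \<noteq> {})"
    unfolding biconvex_hull_def by blast
  also have "\<dots> \<longleftrightarrow> (\<forall>\<sigma>\<in>{1,-1}. \<forall>\<tau>\<in>{1,-1}. \<forall>y. p \<in> quadrant ((\<sigma> / sqrt 2) *\<^sub>R b1 \<theta> + (\<tau> / sqrt 2) *\<^sub>R b2 \<theta>) y \<longrightarrow>
     quadrant ((\<sigma> / sqrt 2) *\<^sub>R b1 \<theta> + (\<tau> / sqrt 2) *\<^sub>R b2 \<theta>) y \<inter> A \<noteq> {})"
    unfolding quadrant_dirs by blast
  also have "\<dots> \<longleftrightarrow> (\<forall>\<sigma>\<in>{1,-1}. \<forall>\<tau>\<in>{1,-1}. \<forall>y. 0 < \<sigma> * (b1 \<theta> \<bullet> (p - y)) \<and> 0 < \<tau> * (b2 \<theta> \<bullet> (p - y)) \<longrightarrow>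
       (\<exists>z\<in>A. 0 < \<sigma> * (b1 \<theta> \<bullet> (z - y)) \<and> 0 < \<tau> * (b2 \<theta> \<bullet> (z - y))))"
    by (intro ball_cong refl) (simp only: quadrant_frame_eq, blast)
  finally show ?thesis .
qed

definition in_quad :: "real \<Rightarrow> real \<Rightarrow> real \<Rightarrow> real^2 \<Rightarrow> real^2 \<Rightarrow> bool" where
  "in_quad \<theta> \<sigma> \<tau> p z \<longleftrightarrow> 0 \<le> \<sigma> * (b1 \<theta> \<bullet> (z - p)) \<and> 0 \<le> \<tau> * (b2 \<theta> \<bullet> (z - p))"

text \<open>An open quadrant containing \<open>p\<close> contains the closed quadrant with vertex
  \<open>p\<close>. Conversely, a closed quadrant at \<open>p\<close> that misses the compact set
  \<open>A\<close> misses it by a margin, so its vertex can be moved back a little to give an open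
  quadrant that contains \<open>p\<close> and still misses \<open>A\<close>.\<close>

lemma mem_biconvex_hull_iff_closed_quadrants:
  assumes "compact A"
  shows "p \<in> biconvex_hull \<theta> A \<longleftrightarrow> (\<forall>\<sigma>\<in>{1,-1}. \<forall>\<tau>\<in>{1,-1}. \<exists>z\<in>A. in_quad \<theta> \<sigma> \<tau> p z)"
proof
  assume p: "p \<in> biconvex_hull \<theta> A"
  show "\<forall>\<sigma>\<in>{1,-1}. \<forall>\<tau>\<in>{1,-1}. \<exists>z\<in>A. in_quad \<theta> \<sigma> \<tau> p z"
  proof (intro ballI, rule ccontr)
    fix \<sigma> \<tau> :: real
    assume st: "\<sigma> \<in> {1,-1}" "\<tau> \<in> {1,-1}" and no: "\<not> (\<exists>z\<in>A. in_quad \<theta> \<sigma> \<tau> p z)"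
    let ?f = "\<lambda>z. min (\<sigma> * (b1 \<theta> \<bullet> (z - p))) (\<tau> * (b2 \<theta> \<bullet> (z - p)))"
    have neg: "?f z < 0" if "z \<in> A" for z
      using no that by (auto simp: in_quad_def min_def not_le)
    \<comment> \<open>The margin \<open>m\<close> is minus the maximum of \<open>?f\<close> on
      \<open>A\<close>; if \<open>A\<close> is empty, any positive number serves, here 1.\<close>
    obtain m where m: "0 < m" "\<And>z. z \<in> A \<Longrightarrow> ?f z \<le> - m"
    proof (cases "A = {}")
      case False
      have "continuous_on A ?f" by (intro continuous_intros)
      with continuous_attains_sup[OF assms False this] obtain z0 where z0: "z0 \<in> A" "\<And>z. z \<in> A \<Longrightarrow> ?f z \<le> ?f z0"
        by auto
      show ?thesis by (rule that[of "- ?f z0"]) (use neg[OF z0(1)] z0(2) in auto)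
    qed (use that[of 1] in auto)
    define y where "y = p - ((\<sigma> * m) *\<^sub>R b1 \<theta> + (\<tau> * m) *\<^sub>R b2 \<theta>)"
    have c: "\<sigma> * (b1 \<theta> \<bullet> (z - y)) = \<sigma> * (b1 \<theta> \<bullet> (z - p)) + m"
            "\<tau> * (b2 \<theta> \<bullet> (z - y)) = \<tau> * (b2 \<theta> \<bullet> (z - p)) + m" for z
      using st by (auto simp: y_def inner_diff_right inner_add_right)
    have "0 < \<sigma> * (b1 \<theta> \<bullet> (p - y)) \<and> 0 < \<tau> * (b2 \<theta> \<bullet> (p - y))"
      unfolding c using m by simp
    then obtain z where "z \<in> A" "0 < \<sigma> * (b1 \<theta> \<bullet> (z - y))" "0 < \<tau> * (b2 \<theta> \<bullet> (z - y))"
      using p st unfolding mem_biconvex_hull_iff_open_quadrants by blast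
    with m(2)[of z] show False unfolding c by (auto simp: min_le_iff_disj)
  qed
next
  assume r: "\<forall>\<sigma>\<in>{1,-1}. \<forall>\<tau>\<in>{1,-1}. \<exists>z\<in>A. in_quad \<theta> \<sigma> \<tau> p z"
  show "p \<in> biconvex_hull \<theta> A"
    unfolding mem_biconvex_hull_iff_open_quadrants
  proof (intro ballI allI impI)
    fix \<sigma> \<tau> y assume st: "\<sigma> \<in> {1,-1::real}" "\<tau> \<in> {1,-1::real}"
      and y: "0 < \<sigma> * (b1 \<theta> \<bullet> (p - y)) \<and> 0 < \<tau> * (b2 \<theta> \<bullet> (p - y))"
    obtain z where z: "z \<in> A" "in_quad \<theta> \<sigma> \<tau> p z" using r st by blast
    have "\<sigma> * (b1 \<theta> \<bullet> (z - y)) = \<sigma> * (b1 \<theta> \<bullet> (z - p)) + \<sigma> * (b1 \<theta> \<bullet> (p - y))"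
         "\<tau> * (b2 \<theta> \<bullet> (z - y)) = \<tau> * (b2 \<theta> \<bullet> (z - p)) + \<tau> * (b2 \<theta> \<bullet> (p - y))"
      by (simp_all add: inner_diff_right algebra_simps)
    then show "\<exists>z\<in>A. 0 < \<sigma> * (b1 \<theta> \<bullet> (z - y)) \<and> 0 < \<tau> * (b2 \<theta> \<bullet> (z - y))"
      using z y by (intro bexI[of _ z]) (auto simp: in_quad_def)
  qed
qed

subsection \<open>Hausdorff distance of the hulls and of their frontiers\<close>

text \<open>If \<open>S\<close> split into two closed parts, its connected frontier would lie in one
  of them. This passes from the hypothesis on the frontier to connectedness of \<open>S\<close>, on
  which the strip argument and the identity of a biconvex set with its hull rely.\<close>

lemma connected_if_connected_frontier:
  fixes S :: "'a::euclidean_space set"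
  assumes S: "compact S" and F: "connected (frontier S)"
  shows "connected S"
proof (rule ccontr)
  assume "\<not> connected S"
  then obtain A B where AB: "closed A" "closed B" "A \<union> B = S" "A \<inter> B = {}" "A \<noteq> {}" "B \<noteq> {}"
    using connected_closed_set[OF compact_imp_closed[OF S]] by auto
  \<comment> \<open>A clopen part avoiding the frontier would be open and bounded.\<close>
  have no: False
    if cl: "closed C" "closed D" and CD: "C \<union> D = S" "C \<inter> D = {}" "D \<noteq> {}" "frontier S \<inter> D = {}" for C D
  proof -
    have "D = interior S - C"
      using CD interior_subset[of S] compact_imp_closed[OF S] by (auto simp: frontier_def)
    then have "open D" using cl by auto
    with cl CD(3) have "D = UNIV" by (metis clopen)
    then have "S = UNIV" using CD(1) by blast
    then show False using compact_imp_bounded[OF S] not_bounded_UNIV by metis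
  qed
  have "frontier S \<subseteq> A \<union> B"
    using AB(3) compact_imp_closed[OF S] frontier_subset_closed by blast
  then have "frontier S \<inter> A = {} \<or> frontier S \<inter> B = {}"
    using connected_closedD[OF F _ _ AB(1,2)] AB(4) by blast
  then show False
    using no[of A B] no[of B A] AB by blast
qed

lemma frontier_crossing:
  fixes p q :: "'a::euclidean_space"
  assumes "p \<in> K" "q \<notin> K"
  obtains f where "f \<in> frontier K" "dist p f \<le> dist p q" "dist q f \<le> dist p q"
proof -
  have "closed_segment p q \<inter> frontier K \<noteq> {}"
    using connected_Int_frontier[of "closed_segment p q" K] assms by auto
  then obtain f where "f \<in> closed_segment p q" "f \<in> frontier K" by blast
  then show ?thesis
    using dist_in_closed_segment[of f p q] by (intro that[of f]) (auto simp: dist_commute)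
qed

section \<open>Monotonicity and compactness of the hull\<close>

lemma subset_biconvex_hull: "A \<subseteq> biconvex_hull \<theta> A"
  by (auto simp: biconvex_hull_def)

lemma biconvex_hull_mono: "A \<subseteq> B \<Longrightarrow> biconvex_hull \<theta> A \<subseteq> biconvex_hull \<theta> B"
  unfolding biconvex_hull_def by blast

lemma closed_biconvex_hull: "closed (biconvex_hull \<theta> A)"
proof -
  have "open (quadrant ((rot ^^ i) (axis_dir \<theta>)) y)" if "i \<in> {0..3}" for i y
  proof -
    have "(rot ^^ i) (axis_dir \<theta>) \<in> (\<lambda>i. (rot ^^ i) (axis_dir \<theta>)) ` {0..3}"
      using that by blast
    then obtain \<sigma> \<tau> where "\<sigma> \<in> {1,-1}" "\<tau> \<in> {1,-1}"
      "(rot ^^ i) (axis_dir \<theta>) = (\<sigma> / sqrt 2) *\<^sub>R b1 \<theta> + (\<tau> / sqrt 2) *\<^sub>R b2 \<theta>"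
      unfolding quadrant_dirs by blast
    then show ?thesis
      by (simp only: quadrant_frame_eq)
        (intro open_Collect_conj open_Collect_less continuous_intros)
  qed
  then show ?thesis
    unfolding biconvex_hull_def by (intro closed_Inter) auto
qed

text \<open>Each coordinate of a hull point lies between those of two points of \<open>A\<close>,
  taken from the quadrants (1, 1) and (-1, -1), so a bound for \<open>A\<close> bounds the
  hull.\<close>

lemma compact_biconvex_hull:
  assumes "compact A"
  shows "compact (biconvex_hull \<theta> A)"
proof -
  obtain C where C: "\<And>z. z \<in> A \<Longrightarrow> norm z \<le> C"
    using compact_imp_bounded[OF assms] by (auto simp: bounded_iff)
  have "norm p \<le> sqrt 2 * C" if "p \<in> biconvex_hull \<theta> A" for p
  proof -
    have "\<exists>z\<in>A. in_quad \<theta> 1 1 p z" "\<exists>w\<in>A. in_quad \<theta> (-1) (-1) p w"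
      using that unfolding mem_biconvex_hull_iff_closed_quadrants[OF assms] by simp_all
    then obtain z w where zw: "z \<in> A" "in_quad \<theta> 1 1 p z" "w \<in> A" "in_quad \<theta> (-1) (-1) p w"
      by blast
    have le: "\<bar>b1 \<theta> \<bullet> v\<bar> \<le> C \<and> \<bar>b2 \<theta> \<bullet> v\<bar> \<le> C" if "v \<in> A" for v
      using C[OF that] abs_inner_b_le[of \<theta> v] by auto
    have "\<bar>b1 \<theta> \<bullet> p\<bar> \<le> C \<and> \<bar>b2 \<theta> \<bullet> p\<bar> \<le> C"
      using zw(2,4) le[OF zw(1)] le[OF zw(3)] by (auto simp: in_quad_def inner_diff_right intro!: abs_leI)
    then show ?thesis by (intro norm_le_sqrt2) auto
  qed
  then have "bounded (biconvex_hull \<theta> A)" by (auto simp: bounded_iff)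
  then show ?thesis using closed_biconvex_hull compact_eq_bounded_closed by blast
qed

text \<open>An \<open>e\<close>-net in the maximum norm of the frame coordinates. Quadrants interact
  with this norm without loss, so Euclidean distances appear only at the end.\<close>

definition sup_net :: "real \<Rightarrow> real \<Rightarrow> (real^2) set \<Rightarrow> (real^2) set \<Rightarrow> bool" where
  "sup_net \<theta> e S X \<longleftrightarrow> (\<forall>s\<in>S. \<exists>x\<in>X. \<bar>b1 \<theta> \<bullet> (x - s)\<bar> \<le> e \<and> \<bar>b2 \<theta> \<bullet> (x - s)\<bar> \<le> e)"

lemma sign_mult_ge: "\<sigma> \<in> {1,-1::real} \<Longrightarrow> \<bar>a\<bar> \<le> e \<Longrightarrow> - e \<le> \<sigma> * a"
  by auto

text \<open>Replacing a witness \<open>s\<close> in a closed quadrant by a net point costs at most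
  \<open>e\<close> in each coordinate, so the net point lies in the quadrant with its vertex moved
  back by \<open>e\<close>.\<close>

lemma net_in_shifted_quad:
  assumes "sup_net \<theta> e S X" "s \<in> S" "in_quad \<theta> \<sigma> \<tau> p s" "\<sigma> \<in> {1,-1}" "\<tau> \<in> {1,-1}"
  obtains x where "x \<in> X" "- e \<le> \<sigma> * (b1 \<theta> \<bullet> (x - p))" "- e \<le> \<tau> * (b2 \<theta> \<bullet> (x - p))"
proof -
  obtain x where x: "x \<in> X" "\<bar>b1 \<theta> \<bullet> (x - s)\<bar> \<le> e" "\<bar>b2 \<theta> \<bullet> (x - s)\<bar> \<le> e"
    using assms by (auto simp: sup_net_def)
  have "\<sigma> * (b1 \<theta> \<bullet> (x - p)) = \<sigma> * (b1 \<theta> \<bullet> (x - s)) + \<sigma> * (b1 \<theta> \<bullet> (s - p))"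
       "\<tau> * (b2 \<theta> \<bullet> (x - p)) = \<tau> * (b2 \<theta> \<bullet> (x - s)) + \<tau> * (b2 \<theta> \<bullet> (s - p))"
    by (simp_all add: inner_diff_right algebra_simps)
  moreover have "- e \<le> \<sigma> * (b1 \<theta> \<bullet> (x - s))" "- e \<le> \<tau> * (b2 \<theta> \<bullet> (x - s))"
    using x assms(4,5) by (auto intro: sign_mult_ge)
  ultimately show ?thesis
    using assms(3) x by (intro that[of x]) (auto simp: in_quad_def)
qed

text \<open>For each sign pair, the corner of the square around \<open>p\<close> in that direction
  has a witness in \<open>S\<close>. The net point near it falls back by at most \<open>e\<close>
  per coordinate, which the shift to the corner compensates. Read contrapositively: outside the hull
  of \<open>X\<close>, some corner leaves the hull of \<open>S\<close>.\<close>

lemma mem_biconvex_hull_if_shifts: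
  assumes "compact S" "compact X" "sup_net \<theta> e S X"
    and sh: "\<And>\<sigma> \<tau>. \<sigma> \<in> {1,-1} \<Longrightarrow> \<tau> \<in> {1,-1} \<Longrightarrow> p + ((\<sigma> * e) *\<^sub>R b1 \<theta> + (\<tau> * e) *\<^sub>R b2 \<theta>) \<in> biconvex_hull \<theta> S"
  shows "p \<in> biconvex_hull \<theta> X"
  unfolding mem_biconvex_hull_iff_closed_quadrants[OF assms(2)]
proof (intro ballI)
  fix \<sigma> \<tau> assume st: "\<sigma> \<in> {1,-1::real}" "\<tau> \<in> {1,-1::real}"
  let ?p = "p + ((\<sigma> * e) *\<^sub>R b1 \<theta> + (\<tau> * e) *\<^sub>R b2 \<theta>)"
  obtain s where s: "s \<in> S" "in_quad \<theta> \<sigma> \<tau> ?p s"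
    using sh[OF st] st unfolding mem_biconvex_hull_iff_closed_quadrants[OF assms(1)] by blast
  obtain x where x: "x \<in> X" "- e \<le> \<sigma> * (b1 \<theta> \<bullet> (x - ?p))" "- e \<le> \<tau> * (b2 \<theta> \<bullet> (x - ?p))"
    using net_in_shifted_quad[OF assms(3) s st] .
  then have "in_quad \<theta> \<sigma> \<tau> p x"
    using st by (auto simp: in_quad_def inner_diff_right inner_add_right)
  then show "\<exists>z\<in>X. in_quad \<theta> \<sigma> \<tau> p z" using x by blast
qed

text \<open>In coordinates oriented by the signs \<open>\<sigma>\<close> and \<open>\<tau>\<close>, the witness takes the larger first coordinate of
  \<open>n\<close> and \<open>z\<close> and the larger second coordinate of \<open>m\<close> and \<open>z\<close>.\<close>

lemma recombined_point_in_hull: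
  assumes X: "compact X" and st: "\<sigma> \<in> {1,-1}" "\<tau> \<in> {1,-1}"
    and mem: "n \<in> X" "m \<in> X" "z \<in> X"
    and n: "\<bar>b1 \<theta> \<bullet> (n - p)\<bar> \<le> e" "e < \<tau> * (b2 \<theta> \<bullet> (n - p))"
    and m: "e < \<sigma> * (b1 \<theta> \<bullet> (m - p))" "\<bar>b2 \<theta> \<bullet> (m - p)\<bar> \<le> e"
    and z: "\<sigma> * (b1 \<theta> \<bullet> (z - p)) \<le> e" "\<tau> * (b2 \<theta> \<bullet> (z - p)) \<le> e"
  shows "\<exists>q\<in>biconvex_hull \<theta> X. \<bar>b1 \<theta> \<bullet> (q - p)\<bar> \<le> e \<and> \<bar>b2 \<theta> \<bullet> (q - p)\<bar> \<le> e"
proof -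
  let ?x = "\<lambda>w. \<sigma> * (b1 \<theta> \<bullet> (w - p))" and ?y = "\<lambda>w. \<tau> * (b2 \<theta> \<bullet> (w - p))"
  define a where "a = max (?x n) (?x z)"
  define b where "b = max (?y m) (?y z)"
  define q where "q = p + ((\<sigma> * a) *\<^sub>R b1 \<theta> + (\<tau> * b) *\<^sub>R b2 \<theta>)"
  have nm: "\<bar>?x n\<bar> \<le> e" "\<bar>?y m\<bar> \<le> e" using n m st by auto
  have q: "b1 \<theta> \<bullet> (q - p) = \<sigma> * a" "b2 \<theta> \<bullet> (q - p) = \<tau> * b" by (auto simp: q_def)
  have "\<bar>a\<bar> \<le> e" "\<bar>b\<bar> \<le> e" using nm z by (auto simp: a_def b_def)
  then have small: "\<bar>b1 \<theta> \<bullet> (q - p)\<bar> \<le> e" "\<bar>b2 \<theta> \<bullet> (q - p)\<bar> \<le> e" using st q by auto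
  \<comment> \<open>As \<sigma> and \<tau> square to 1, the quadrants at \<open>q\<close> can be
    tested in the oriented coordinates \<open>?x\<close>, \<open>?y\<close>; the test signs become
    the products with \<sigma> and \<tau>.\<close>
  have quad: "in_quad \<theta> \<alpha> \<beta> q w \<longleftrightarrow> 0 \<le> \<alpha> * \<sigma> * (?x w - a) \<and> 0 \<le> \<beta> * \<tau> * (?y w - b)" for \<alpha> \<beta> w
  proof -
    have "b1 \<theta> \<bullet> (w - q) = b1 \<theta> \<bullet> (w - p) - \<sigma> * a" "b2 \<theta> \<bullet> (w - q) = b2 \<theta> \<bullet> (w - p) - \<tau> * b"
      using q by (simp_all add: inner_diff_right algebra_simps)
    moreover have "\<alpha> * \<sigma> * (?x w - a) = \<alpha> * (b1 \<theta> \<bullet> (w - p) - \<sigma> * a)"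
      using st by (auto simp: algebra_simps)
    moreover have "\<beta> * \<tau> * (?y w - b) = \<beta> * (b2 \<theta> \<bullet> (w - p) - \<tau> * b)"
      using st by (auto simp: algebra_simps)
    ultimately show ?thesis by (simp only: in_quad_def)
  qed
  have sw: "?x z \<le> a" "?y z \<le> b" 
    "a \<le> ?x m" "b \<le> ?y n"
    using m n \<open>\<bar>a\<bar> \<le> e\<close> \<open>\<bar>b\<bar> \<le> e\<close> by (auto simp: a_def b_def)
  \<comment> \<open>In oriented coordinates \<open>m\<close> serves the quadrant (1, -1),
    \<open>n\<close> serves (-1, 1) and \<open>z\<close> serves (-1, -1). The quadrant (1, 1) is
    served by \<open>n\<close> if it attains the maximum \<open>a\<close>, by \<open>m\<close> if it
    attains \<open>b\<close>, and otherwise by \<open>z\<close>, which then attains both.\<close>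
  have corner: "\<exists>w\<in>X. 0 \<le> \<alpha> * (?x w - a) \<and> 0 \<le> \<beta> * (?y w - b)" if "\<alpha> \<in> {1,-1}" "\<beta> \<in> {1,-1}" for \<alpha> \<beta>
  proof -
    have "0 \<le> ?x n - a \<and> 0 \<le> ?y n - b \<or> 0 \<le> ?x m - a \<and> 0 \<le> ?y m - b \<or> 0 \<le> ?x z - a \<and> 0 \<le> ?y z - b"
      using sw by (auto simp: a_def b_def max_def)
    then have "\<exists>w\<in>X. 0 \<le> ?x w - a \<and> 0 \<le> ?y w - b" using mem by blast
    moreover have "?x n \<le> a" "?y m \<le> b" by (auto simp: a_def b_def)
    ultimately show ?thesis using that sw mem by fastforce
  qed
  have "q \<in> biconvex_hull \<theta> X"
    unfolding mem_biconvex_hull_iff_closed_quadrants[OF X] quad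
  proof (intro ballI)
    fix \<alpha> \<beta> assume "\<alpha> \<in> {1,-1::real}" "\<beta> \<in> {1,-1::real}"
    then have "\<alpha> * \<sigma> \<in> {1,-1}" "\<beta> * \<tau> \<in> {1,-1}" using st by auto
    then show "\<exists>w\<in>X. 0 \<le> \<alpha> * \<sigma> * (?x w - a) \<and> 0 \<le> \<beta> * \<tau> * (?y w - b)" by (rule corner)
  qed
  with small show ?thesis by blast
qed


text \<open>If a point of \<open>X\<close> found in one strip around \<open>p\<close> lies in the
  other strip too, it is the required point itself. Otherwise the two strip points leave the square
  around \<open>p\<close> through adjacent sides, and a third point from the opposite quadrant
  completes them for recombination.\<close>

lemma biconvex_hull_point_near:
  assumes S: "compact S" "connected S" and X: "compact X" "X \<subseteq> S" and net: "sup_net \<theta> e S X"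
    and p: "p \<in> biconvex_hull \<theta> S"
  shows "\<exists>q\<in>biconvex_hull \<theta> X. \<bar>b1 \<theta> \<bullet> (q - p)\<bar> \<le> e \<and> \<bar>b2 \<theta> \<bullet> (q - p)\<bar> \<le> e"
proof -
  have quad: "\<exists>s\<in>S. in_quad \<theta> \<sigma> \<tau> p s" if "\<sigma> \<in> {1,-1}" "\<tau> \<in> {1,-1}" for \<sigma> \<tau>
    using p that unfolding mem_biconvex_hull_iff_closed_quadrants[OF S(1)] by blast
  \<comment> \<open>Here \<open>f\<close> is one of the two coordinates. Witnesses in opposite
    quadrants lie on both sides of \<open>p\<close>, so connectedness gives a point of
    \<open>S\<close> with the same \<open>f\<close>-value as \<open>p\<close>, and a net point is
    within \<open>e\<close> of it.\<close>
  have strip: "\<exists>x\<in>X. \<bar>f (x - p)\<bar> \<le> e"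
    if f: "linear f" and sgn: "\<And>u v. in_quad \<theta> 1 1 u v \<Longrightarrow> 0 \<le> f (v - u)" "\<And>u v. in_quad \<theta> (-1) (-1) u v \<Longrightarrow> f (v - u) \<le> 0"
      and net: "\<And>s. s \<in> S \<Longrightarrow> \<exists>x\<in>X. \<bar>f (x - s)\<bar> \<le> e" for f :: "real^2 \<Rightarrow> real"
  proof -
    obtain s t where st: "s \<in> S" "t \<in> S" "f p \<le> f s" "f t \<le> f p"
      using quad[of 1 1] quad[of "-1" "-1"] sgn linear_diff[OF f] by fastforce
    have "connected (f ` S)"
      using f S(2) by (intro connected_continuous_image linear_continuous_on) (auto simp: linear_conv_bounded_linear)
    then have "f p \<in> f ` S"
      using st by (meson connectedD_interval imageI)
    then obtain s where s: "s \<in> S" "f s = f p" by auto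
    then show ?thesis using net[of s] by (auto simp: linear_diff[OF f])
  qed
  obtain n where n: "n \<in> X" "\<bar>b1 \<theta> \<bullet> (n - p)\<bar> \<le> e"
    using strip[of "(\<bullet>) (b1 \<theta>)"] net by (auto simp: sup_net_def in_quad_def bounded_linear_inner_right[THEN bounded_linear.linear])
  obtain m where m: "m \<in> X" "\<bar>b2 \<theta> \<bullet> (m - p)\<bar> \<le> e"
    using strip[of "(\<bullet>) (b2 \<theta>)"] net by (auto simp: sup_net_def in_quad_def bounded_linear_inner_right[THEN bounded_linear.linear])
  show ?thesis
  proof (cases "\<bar>b2 \<theta> \<bullet> (n - p)\<bar> \<le> e \<or> \<bar>b1 \<theta> \<bullet> (m - p)\<bar> \<le> e")
    case True
    then show ?thesis using n m subset_biconvex_hull by blast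
  next
    case False
    have sgn: "\<exists>\<sigma>\<in>{1,-1}. e < \<sigma> * r" if "\<not> \<bar>r\<bar> \<le> e" for r :: real
      using that by (auto simp: abs_if split: if_splits)
    \<comment> \<open>The signs record on which side of the square \<open>n\<close> and
      \<open>m\<close> lie; \<open>z\<close> is then sought on the opposite sides.\<close>
    obtain \<sigma> \<tau> where st: "\<sigma> \<in> {1,-1}" "\<tau> \<in> {1,-1}"
      "e < \<tau> * (b2 \<theta> \<bullet> (n - p))" "e < \<sigma> * (b1 \<theta> \<bullet> (m - p))"
      using sgn False by meson
    have st': "-\<sigma> \<in> {1,-1}" "-\<tau> \<in> {1,-1}" using st by auto
    obtain s where "s \<in> S" "in_quad \<theta> (-\<sigma>) (-\<tau>) p s" using quad[OF st'] by blast
    then obtain z where "z \<in> X" "- e \<le> -\<sigma> * (b1 \<theta> \<bullet> (z - p))" "- e \<le> -\<tau> * (b2 \<theta> \<bullet> (z - p))"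
      using net_in_shifted_quad[OF net _ _ st'] by blast
    then show ?thesis
      using recombined_point_in_hull[OF X(1) st(1,2) n(1) m(1) _ n(2) st(3,4) m(2)] by auto
  qed
qed

section \<open>From coordinate estimates to Hausdorff distances\<close>

lemma hausdorff_dist_le:
  assumes "A \<noteq> {}" "C \<noteq> {}"
    and "\<And>a. a \<in> A \<Longrightarrow> infdist a C \<le> r" "\<And>c. c \<in> C \<Longrightarrow> infdist c A \<le> r"
  shows "hausdorff_dist A C \<le> r"
  unfolding hausdorff_dist_def using assms by (auto intro!: cSUP_least)

lemma infdist_le_hausdorff_dist:
  assumes "compact A" "a \<in> A"
  shows "infdist a C \<le> hausdorff_dist A C"
proof -
  have "compact ((\<lambda>a. infdist a C) ` A)"
    using assms(1) by (intro compact_continuous_image continuous_intros)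
  then have "bdd_above ((\<lambda>a. infdist a C) ` A)"
    by (simp add: bounded_imp_bdd_above compact_imp_bounded)
  then have "infdist a C \<le> (SUP a\<in>A. infdist a C)"
    using assms(2) by (rule cSUP_upper2) simp
  then show ?thesis by (simp add: hausdorff_dist_def)
qed

lemma hausdorff_dist_nonneg:
  assumes "compact A" "A \<noteq> {}"
  shows "0 \<le> hausdorff_dist A C"
  using assms infdist_le_hausdorff_dist infdist_nonneg order_trans by (metis all_not_in_conv)

lemma sup_net_hausdorff_dist:
  assumes "compact S" "compact X" "X \<noteq> {}"
  shows "sup_net \<theta> (hausdorff_dist S X) S X"
  unfolding sup_net_def
proof
  fix s assume "s \<in> S"
  obtain x where "x \<in> X" "infdist s X = dist s x"
    using infdist_attains_inf[OF compact_imp_closed[OF assms(2)] assms(3)] by blast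
  then have "norm (x - s) \<le> hausdorff_dist S X"
    using infdist_le_hausdorff_dist[OF assms(1) \<open>s \<in> S\<close>, of X] by (simp add: dist_norm norm_minus_commute)
  then show "\<exists>x\<in>X. \<bar>b1 \<theta> \<bullet> (x - s)\<bar> \<le> hausdorff_dist S X \<and> \<bar>b2 \<theta> \<bullet> (x - s)\<bar> \<le> hausdorff_dist S X"
    using abs_inner_b_le[of \<theta> "x - s"] \<open>x \<in> X\<close> by force
qed

lemma biconvex_hull_dist_le:
  assumes "compact S" "connected S" "compact X" "X \<subseteq> S" "X \<noteq> {}" "p \<in> biconvex_hull \<theta> S"
  obtains q where "q \<in> biconvex_hull \<theta> X" "dist p q \<le> sqrt 2 * hausdorff_dist S X"
proof -
  obtain q where "q \<in> biconvex_hull \<theta> X" "\<bar>b1 \<theta> \<bullet> (q - p)\<bar> \<le> hausdorff_dist S X" "\<bar>b2 \<theta> \<bullet> (q - p)\<bar> \<le> hausdorff_dist S X"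
    using biconvex_hull_point_near[OF assms(1-4) sup_net_hausdorff_dist[OF assms(1,3,5)] assms(6)] by blast
  then show ?thesis
    using norm_le_sqrt2[of \<theta> "q - p"] by (intro that[of q]) (auto simp: dist_norm norm_minus_commute)
qed

text \<open>The hull of \<open>X\<close> is contained in that of \<open>S\<close>, so only the
  distance from points of the larger hull to the smaller one matters.\<close>

lemma hausdorff_dist_hull_le:
  assumes "compact S" "connected S" "compact X" "X \<subseteq> S" "X \<noteq> {}"
  shows "hausdorff_dist (biconvex_hull \<theta> X) (biconvex_hull \<theta> S) \<le> sqrt 2 * hausdorff_dist S X"
proof (rule hausdorff_dist_le)
  show "biconvex_hull \<theta> X \<noteq> {}" "biconvex_hull \<theta> S \<noteq> {}"
    using assms subset_biconvex_hull by blast+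
  have nn: "0 \<le> hausdorff_dist S X" using assms by (intro hausdorff_dist_nonneg) auto
  show "infdist a (biconvex_hull \<theta> S) \<le> sqrt 2 * hausdorff_dist S X" if "a \<in> biconvex_hull \<theta> X" for a
    using that biconvex_hull_mono[OF assms(4), of \<theta>] nn by (auto intro: infdist_le2[of a])
  show "infdist c (biconvex_hull \<theta> X) \<le> sqrt 2 * hausdorff_dist S X" if "c \<in> biconvex_hull \<theta> S" for c
    using biconvex_hull_dist_le[OF assms that] infdist_le2 by metis
qed

lemma frontier_nonempty_compact:
  fixes K :: "'a::euclidean_space set"
  assumes "compact K" "K \<noteq> {}"
  shows "frontier K \<noteq> {}"
  using assms frontier_eq_empty not_bounded_UNIV compact_imp_bounded by metis

text \<open>Both directions find a frontier point on a segment whose ends lie inside and outside the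
  relevant hull. From the frontier of the larger hull the segment leads to a nearby point of the
  smaller one; in the other direction it leads to a point outside the larger hull supplied by the
  corner criterion.\<close>

lemma hausdorff_dist_frontier_hull_le:
  assumes "compact S" "connected S" "compact X" "X \<subseteq> S" "X \<noteq> {}"
  shows "hausdorff_dist (frontier (biconvex_hull \<theta> S)) (frontier (biconvex_hull \<theta> X)) \<le> sqrt 2 * hausdorff_dist S X"
proof (rule hausdorff_dist_le)
  let ?S = "biconvex_hull \<theta> S" and ?X = "biconvex_hull \<theta> X" and ?d = "hausdorff_dist S X"
  note cS = compact_biconvex_hull[OF assms(1), of \<theta>] and cX = compact_biconvex_hull[OF assms(3), of \<theta>]
  have XS: "?X \<subseteq> ?S" using assms(4) by (rule biconvex_hull_mono)
  have ne: "?X \<noteq> {}" "?S \<noteq> {}"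
    using assms subset_biconvex_hull by blast+
  then show "frontier ?S \<noteq> {}" "frontier ?X \<noteq> {}"
    using cS cX by (simp_all add: frontier_nonempty_compact)
  have nn: "0 \<le> ?d" using assms by (intro hausdorff_dist_nonneg) auto
  show "infdist p (frontier ?X) \<le> sqrt 2 * ?d" if p: "p \<in> frontier ?S" for p
  proof (cases "p \<in> ?X")
    case True
    \<comment> \<open>An interior point of the smaller hull would be interior to the larger
      one.\<close>
    then have "p \<in> frontier ?X"
      using p interior_mono[OF XS] closure_subset by (auto simp: frontier_def)
    then show ?thesis using nn by simp
  next
    case False
    have "p \<in> ?S" using p frontier_subset_closed[OF closed_biconvex_hull] by blast
    then obtain q where "q \<in> ?X" "dist p q \<le> sqrt 2 * ?d" by (rule biconvex_hull_dist_le[OF assms])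
    then show ?thesis
      using frontier_crossing[of q ?X p] False infdist_le2 by (metis dist_commute order_trans)
  qed
  show "infdist q (frontier ?S) \<le> sqrt 2 * ?d" if q: "q \<in> frontier ?X" for q
  \<comment> \<open>The corner criterion needs a point outside the closed hull of \<open>X\<close>,
    whereas \<open>q\<close> belongs to it; the slack \<delta> pays for the move from
    \<open>q\<close> to such a point \<open>r\<close>.\<close>
  proof (rule field_le_epsilon)
    fix \<delta> :: real assume "0 < \<delta>"
    then obtain r where r: "r \<notin> ?X" "dist q r < \<delta>"
      using q unfolding frontier_straddle by blast
    obtain \<sigma> \<tau> where st: "\<sigma> \<in> {1,-1}" "\<tau> \<in> {1,-1}" "r + ((\<sigma> * ?d) *\<^sub>R b1 \<theta> + (\<tau> * ?d) *\<^sub>R b2 \<theta>) \<notin> ?S"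
      using mem_biconvex_hull_if_shifts[OF assms(1,3) sup_net_hausdorff_dist[OF assms(1,3,5)]] r(1) by blast
    have "norm ((\<sigma> * ?d) *\<^sub>R b1 \<theta> + (\<tau> * ?d) *\<^sub>R b2 \<theta>) \<le> sqrt 2 * ?d"
      using st nn by (intro norm_le_sqrt2[of \<theta>]) auto
    then have "dist r (r + ((\<sigma> * ?d) *\<^sub>R b1 \<theta> + (\<tau> * ?d) *\<^sub>R b2 \<theta>)) \<le> sqrt 2 * ?d"
      by (metis add_diff_cancel_left' dist_commute dist_norm)
    then have d: "dist q (r + ((\<sigma> * ?d) *\<^sub>R b1 \<theta> + (\<tau> * ?d) *\<^sub>R b2 \<theta>)) \<le> sqrt 2 * ?d + \<delta>"
      using r(2) by (smt (verit) dist_triangle)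
    have "q \<in> ?S" using q XS frontier_subset_closed[OF closed_biconvex_hull] by blast
    then obtain f where "f \<in> frontier ?S" "dist q f \<le> dist q (r + ((\<sigma> * ?d) *\<^sub>R b1 \<theta> + (\<tau> * ?d) *\<^sub>R b2 \<theta>))"
      using frontier_crossing[OF _ st(3)] by blast
    with d have "f \<in> frontier ?S" "dist q f \<le> sqrt 2 * ?d + \<delta>" by auto
    then show "infdist q (frontier ?S) \<le> sqrt 2 * ?d + \<delta>" by (rule infdist_le2)
  qed
qed

subsection \<open>Fibres and the Minkowski content\<close>

text \<open>A quarter turn exchanges the axes up to sign, so every statement about fibres along
  \<open>b2 \<theta>\<close> also yields one along \<open>b1 \<theta>\<close>.\<close>

lemma b1_shift [simp]: "b1 (\<theta> + pi / 2) = b2 \<theta>" and b2_shift [simp]: "b2 (\<theta> + pi / 2) = - b1 \<theta>"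
  by (simp_all add: b1_def b2_def vec_eq_iff forall_2 sin_add cos_add)

section \<open>Fubini in the rotated frame\<close>

lemma measurable_vec2 [measurable]: "(\<lambda>(s, t). vector [s, t] :: real^2) \<in> borel_measurable (lborel \<Otimes>\<^sub>M lborel)"
proof -
  have "(\<lambda>(s, t). vector [s, t] :: real^2) = (\<lambda>p. fst p *\<^sub>R axis 1 1 + snd p *\<^sub>R axis 2 1)"
    by (auto simp: fun_eq_iff vec_eq_iff forall_2 axis_def)
  then show ?thesis
    unfolding lborel_prod measurable_lborel2 by (simp only:) (intro borel_measurable_continuous_onI continuous_intros)
qed

lemma lborel_vec2: "lborel = distr (lborel \<Otimes>\<^sub>M lborel) borel (\<lambda>(s, t). vector [s, t] :: real^2)"
proof (rule lborel_eqI)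
  fix l u :: "real^2" assume lu: "\<And>b. b \<in> Basis \<Longrightarrow> l \<bullet> b \<le> u \<bullet> b"
  have le: "l $ 1 \<le> u $ 1" "l $ 2 \<le> u $ 2"
    using lu[of "axis 1 1"] lu[of "axis 2 1"] by (auto simp: inner_axis)
  have "(\<lambda>(s, t). vector [s, t] :: real^2) -` box l u = {l$1<..<u$1} \<times> {l$2<..<u$2}"
    by (auto simp: box_def Basis_vec_def inner_axis forall_2)
  then have "emeasure (distr (lborel \<Otimes>\<^sub>M lborel) borel (\<lambda>(s, t). vector [s, t] :: real^2)) (box l u)
      = emeasure (lborel \<Otimes>\<^sub>M lborel) ({l$1<..<u$1} \<times> {l$2<..<u$2})"
    by (simp add: emeasure_distr[OF measurable_vec2] space_pair_measure)
  also have "\<dots> = ennreal ((u$1 - l$1) * (u$2 - l$2))"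
    using le by (simp add: lborel.emeasure_pair_measure_Times ennreal_mult)
  also have "(u$1 - l$1) * (u$2 - l$2) = (\<Prod>b\<in>Basis. (u - l) \<bullet> b)"
  proof -
    have *: "(Basis :: (real^2) set) = {axis 1 1, axis 2 1}"
      by (auto simp: Basis_vec_def UNIV_2)
    have "axis 1 1 \<noteq> (axis 2 1 :: real^2)" by (simp add: axis_eq_axis)
    then show ?thesis unfolding * by (simp add: inner_axis)
  qed
  finally show "emeasure (distr (lborel \<Otimes>\<^sub>M lborel) borel (\<lambda>(s, t). vector [s, t] :: real^2)) (box l u)
      = ennreal (\<Prod>b\<in>Basis. (u - l) \<bullet> b)" .
qed simp

definition fibre :: "real \<Rightarrow> (real^2) set \<Rightarrow> real \<Rightarrow> real set" where
  "fibre \<theta> A s = {t. s *\<^sub>R b1 \<theta> + t *\<^sub>R b2 \<theta> \<in> A}"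

text \<open>Cavalieri's principle along the frame: the passage \<open>H\<close> to frame coordinates
  is an orthogonal transformation with inverse \<open>G\<close>, so it preserves measure, and in
  standard coordinates the claim is Fubini for the product measure.\<close>

lemma emeasure_fibres:
  assumes A: "A \<in> sets borel" and fin: "bounded A"
  shows "emeasure lborel A = (\<integral>\<^sup>+s. emeasure lborel (fibre \<theta> A s) \<partial>lborel)"
proof -
  define G :: "real^2 \<Rightarrow> real^2" where "G x = (x$1) *\<^sub>R b1 \<theta> + (x$2) *\<^sub>R b2 \<theta>" for x
  define H :: "real^2 \<Rightarrow> real^2" where "H x = vector [b1 \<theta> \<bullet> x, b2 \<theta> \<bullet> x]" for x
  have HG: "H (G x) = x" for x by (simp add: H_def G_def vec_eq_iff forall_2)
  have GH: "G (H x) = x" for x by (simp add: H_def G_def flip: frame_expansion)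
  have "linear H"
    by (rule linearI) (simp_all add: H_def vec_eq_iff forall_2 inner_add_right)
  moreover have "norm (H x) = norm x" for x
  proof -
    have "(norm (H x))\<^sup>2 = (norm x)\<^sup>2"
      unfolding norm_eq_frame[of x \<theta>] power2_norm_eq_inner[of "H x"]
      by (subst inner_vec_def) (simp add: UNIV_2 H_def power2_eq_square)
    then show ?thesis by simp
  qed
  ultimately have orth: "orthogonal_transformation H"
    by (simp add: orthogonal_transformation)
  have Aleb: "A \<in> lmeasurable"
    using A fin by (intro bounded_set_imp_lmeasurable) auto
  have im: "H ` A = G -` A"
    using HG GH by (auto simp: image_iff) metis
  have "G \<in> borel_measurable borel"
    unfolding G_def by (intro borel_measurable_continuous_onI continuous_intros)
  then have GA: "G -` A \<in> sets borel" using A by (rule measurable_sets_borel)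
  have "H ` A \<in> lmeasurable" "measure lebesgue (H ` A) = measure lebesgue A"
    using orth Aleb by (rule measurable_orthogonal_image measure_orthogonal_image)+
  then have "emeasure lebesgue A = emeasure lebesgue (G -` A)"
    using Aleb unfolding im by (simp add: emeasure_eq_measure2)
  then have "emeasure lborel A = emeasure lborel (G -` A)"
    using A GA by simp
  also have "\<dots> = emeasure (lborel \<Otimes>\<^sub>M lborel) ((\<lambda>(s, t). vector [s, t]) -` (G -` A))"
    using GA by (subst lborel_vec2, subst emeasure_distr) (auto simp: space_pair_measure)
  also have "\<dots> = (\<integral>\<^sup>+s. emeasure lborel (Pair s -` ((\<lambda>(s, t). vector [s, t]) -` (G -` A))) \<partial>lborel)"
    using measurable_sets[OF measurable_vec2 GA]
    by (intro lborel.emeasure_pair_measure_alt) (simp add: space_pair_measure)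
  also have "\<dots> = (\<integral>\<^sup>+s. emeasure lborel (fibre \<theta> A s) \<partial>lborel)"
    by (simp add: fibre_def G_def vimage_def)
  finally show ?thesis .
qed


section \<open>Wide fibres and neighbourhoods of the frontier\<close>

lemma dist_fibre: "dist (s *\<^sub>R b1 \<theta> + t *\<^sub>R b2 \<theta>) (s *\<^sub>R b1 \<theta> + v *\<^sub>R b2 \<theta>) = \<bar>v - t\<bar>"
proof -
  have "norm (b2 \<theta>) = 1" by (simp add: norm_eq_sqrt_inner)
  then show ?thesis by (simp add: dist_norm abs_minus_commute flip: scaleR_diff_left)
qed

definition wide_fibres :: "real \<Rightarrow> (real^2) set \<Rightarrow> real set" where
  "wide_fibres \<theta> K = {s. \<exists>t\<in>fibre \<theta> K s. \<exists>u\<in>fibre \<theta> K s. t < u}"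

text \<open>Prescribing a gap \<open>d\<close> gives a compact set of parameters and keeps
  neighbourhoods of the two ends of a fibre apart. For positive \<open>d\<close> tending to 0 these
  sets exhaust \<open>wide_fibres\<close>.\<close>

definition fibres_of_length :: "real \<Rightarrow> (real^2) set \<Rightarrow> real \<Rightarrow> real set" where
  "fibres_of_length \<theta> K d = {s. \<exists>t\<in>fibre \<theta> K s. \<exists>u\<in>fibre \<theta> K s. d \<le> u - t}"

lemma mem_fibreI: "p \<in> A \<Longrightarrow> b1 \<theta> \<bullet> p = s \<Longrightarrow> b2 \<theta> \<bullet> p \<in> fibre \<theta> A s"
  using frame_expansion[of p \<theta>] by (auto simp: fibre_def)

text \<open>It is a continuous image of the compact set of pairs in \<open>K\<close> on a common
  line with the prescribed gap.\<close>

lemma compact_fibres_of_length: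
  assumes "compact K"
  shows "compact (fibres_of_length \<theta> K d)"
proof -
  let ?C = "(K \<times> K) \<inter> {(p, q). b1 \<theta> \<bullet> p = b1 \<theta> \<bullet> q \<and> d \<le> b2 \<theta> \<bullet> q - b2 \<theta> \<bullet> p}"
  have "closed {(p, q). b1 \<theta> \<bullet> p = b1 \<theta> \<bullet> q \<and> d \<le> b2 \<theta> \<bullet> q - b2 \<theta> \<bullet> p}"
    unfolding case_prod_unfold
    by (intro closed_Collect_conj closed_Collect_eq closed_Collect_le continuous_intros)
  then have "compact ?C"
    using assms by (intro compact_Int_closed compact_Times)
  moreover have "fibres_of_length \<theta> K d = (\<lambda>(p, q). b1 \<theta> \<bullet> p) ` ?C" (is "?l = ?r")
  proof
    show "?r \<subseteq> ?l"
    proof clarify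
      fix p q assume *: "p \<in> K" "q \<in> K" "b1 \<theta> \<bullet> p = b1 \<theta> \<bullet> q" "d \<le> b2 \<theta> \<bullet> q - b2 \<theta> \<bullet> p"
      then have "b2 \<theta> \<bullet> p \<in> fibre \<theta> K (b1 \<theta> \<bullet> p)" "b2 \<theta> \<bullet> q \<in> fibre \<theta> K (b1 \<theta> \<bullet> p)"
        by (auto intro: mem_fibreI)
      with * show "b1 \<theta> \<bullet> p \<in> ?l" by (auto simp: fibres_of_length_def)
    qed
    show "?l \<subseteq> ?r"
    proof
      fix s assume "s \<in> ?l"
      then obtain t u where "s *\<^sub>R b1 \<theta> + t *\<^sub>R b2 \<theta> \<in> K" "s *\<^sub>R b1 \<theta> + u *\<^sub>R b2 \<theta> \<in> K" "d \<le> u - t"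
        by (auto simp: fibres_of_length_def fibre_def)
      then show "s \<in> ?r"
        by (intro image_eqI[of _ _ "(s *\<^sub>R b1 \<theta> + t *\<^sub>R b2 \<theta>, s *\<^sub>R b1 \<theta> + u *\<^sub>R b2 \<theta>)"]) simp_all
    qed
  qed
  ultimately show ?thesis
    by (auto simp: case_prod_unfold intro!: compact_continuous_image continuous_intros)
qed

lemma compact_fibre:
  assumes "compact K"
  shows "compact (fibre \<theta> K s)"
proof -
  have "fibre \<theta> K s = (\<bullet>) (b2 \<theta>) ` (K \<inter> {p. b1 \<theta> \<bullet> p = s})"
  proof
    show "fibre \<theta> K s \<subseteq> (\<bullet>) (b2 \<theta>) ` (K \<inter> {p. b1 \<theta> \<bullet> p = s})"
    proof
      fix t assume "t \<in> fibre \<theta> K s"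
      then show "t \<in> (\<bullet>) (b2 \<theta>) ` (K \<inter> {p. b1 \<theta> \<bullet> p = s})"
        by (intro image_eqI[of _ _ "s *\<^sub>R b1 \<theta> + t *\<^sub>R b2 \<theta>"]) (simp_all add: fibre_def)
    qed
  qed (auto intro: mem_fibreI)
  moreover have "compact (K \<inter> {p. b1 \<theta> \<bullet> p = s})"
    by (intro compact_Int_closed assms closed_Collect_eq continuous_intros)
  ultimately show ?thesis
    by (auto intro!: compact_continuous_image continuous_intros)
qed

lemma wide_fibres_eq: "wide_fibres \<theta> K = (\<Union>k. fibres_of_length \<theta> K (1 / Suc k))"
proof -
  have small: "\<exists>k. 1 / real (Suc k) \<le> u - t" if "t < u" for t u :: real
    using reals_Archimedean[of "u - t"] that by (auto simp: inverse_eq_divide intro: less_imp_le)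
  have pos: "t < u" if "1 / real (Suc k) \<le> u - t" for t u :: real and k
  proof -
    have "0 < 1 / real (Suc k)" by simp
    with that show ?thesis by linarith
  qed
  show ?thesis
  proof (intro set_eqI iffI)
    fix s assume "s \<in> wide_fibres \<theta> K"
    then obtain t u where tu: "t \<in> fibre \<theta> K s" "u \<in> fibre \<theta> K s" "t < u"
      by (auto simp: wide_fibres_def)
    with small obtain k where "1 / real (Suc k) \<le> u - t" by blast
    with tu have "s \<in> fibres_of_length \<theta> K (1 / Suc k)" by (auto simp: fibres_of_length_def)
    then show "s \<in> (\<Union>k. fibres_of_length \<theta> K (1 / Suc k))" by blast
  next
    fix s assume "s \<in> (\<Union>k. fibres_of_length \<theta> K (1 / Suc k))"
    then obtain k t u where "t \<in> fibre \<theta> K s" "u \<in> fibre \<theta> K s" "1 / real (Suc k) \<le> u - t"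
      by (auto simp: fibres_of_length_def)
    then show "s \<in> wide_fibres \<theta> K"
      using pos unfolding wide_fibres_def by blast
  qed
qed

lemma wide_fibres_measurable:
  assumes "compact K"
  shows "wide_fibres \<theta> K \<in> sets borel"
  unfolding wide_fibres_eq
  by (intro sets.countable_UN) (auto intro: borel_compact compact_fibres_of_length assms)

text \<open>The lowest and the highest point of a fibre of extent at least \<open>d\<close> are
  frontier points of \<open>K\<close>. Their neighbourhoods on the line are two intervals of length
  \<open>2 * \<delta>\<close> that do not overlap, so each such line contributes at least
  \<open>4 * \<delta>\<close> in Fubini's formula.\<close>

lemma emeasure_neighbourhood_ge:
  assumes K: "compact K" and d: "0 < d" "0 < \<delta>" "2 * \<delta> \<le> d"
  shows "4 * \<delta> * measure lborel (fibres_of_length \<theta> K d) \<le> measure lebesgue (\<Union>t\<in>frontier K. cball t \<delta>)"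
proof -
  define T where "T = (\<Union>t\<in>frontier K. cball t \<delta>)"
  \<comment> \<open>Written as a sum of two compact sets, the neighbourhood is seen to be compact,
    hence Borel with finite measure.\<close>
  have "T = {x + y | x y. x \<in> frontier K \<and> y \<in> cball 0 \<delta>}"
  proof (intro set_eqI iffI)
    fix p assume "p \<in> T"
    then obtain x where "x \<in> frontier K" "dist x p \<le> \<delta>" by (auto simp: T_def)
    then show "p \<in> {x + y | x y. x \<in> frontier K \<and> y \<in> cball 0 \<delta>}"
      by (intro CollectI exI[of _ x] exI[of _ "p - x"]) (simp add: dist_norm norm_minus_commute)
  next
    fix p assume "p \<in> {x + y | x y. x \<in> frontier K \<and> y \<in> cball 0 \<delta>}"
    then obtain x y where "p = x + y" "x \<in> frontier K" "norm y \<le> \<delta>" by auto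
    then show "p \<in> T" by (auto simp: T_def dist_norm intro!: bexI[of _ x])
  qed
  then have cT: "compact T"
    using compact_sums[OF compact_frontier[OF K] compact_cball[of 0 \<delta>]] by (simp only:)
  note cC = compact_fibres_of_length[OF K, of \<theta> d]
  have "ennreal (4 * \<delta>) * emeasure lborel (fibres_of_length \<theta> K d)
      = (\<integral>\<^sup>+s. ennreal (4 * \<delta>) * indicator (fibres_of_length \<theta> K d) s \<partial>lborel)"
    using cC by (simp add: nn_integral_cmult_indicator borel_compact)
  also have "\<dots> \<le> (\<integral>\<^sup>+s. emeasure lborel (fibre \<theta> T s) \<partial>lborel)"
  proof (rule nn_integral_mono)
    fix s
    show "ennreal (4 * \<delta>) * indicator (fibres_of_length \<theta> K d) s \<le> emeasure lborel (fibre \<theta> T s)"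
    proof (cases "s \<in> fibres_of_length \<theta> K d")
      case True
      let ?C = "fibre \<theta> K s"
      have C: "compact ?C" "?C \<noteq> {}"
        using True compact_fibre[OF K] by (auto simp: fibres_of_length_def)
      obtain u where u: "u \<in> ?C" "\<And>t. t \<in> ?C \<Longrightarrow> t \<le> u" using compact_attains_sup[OF C] by blast
      obtain l where l: "l \<in> ?C" "\<And>t. t \<in> ?C \<Longrightarrow> l \<le> t" using compact_attains_inf[OF C] by blast
      have lu: "l + \<delta> \<le> u - \<delta>"
        using True u(2) l(2) d by (fastforce simp: fibres_of_length_def)
      have fr: "s *\<^sub>R b1 \<theta> + t *\<^sub>R b2 \<theta> \<in> frontier K"
        if t: "t \<in> ?C" and out: "\<And>e. 0 < e \<Longrightarrow> \<exists>v. \<bar>v - t\<bar> < e \<and> v \<notin> ?C" for t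
        unfolding frontier_straddle
      proof (intro allI impI conjI)
        fix e :: real assume "0 < e"
        then show "\<exists>x\<in>K. dist (s *\<^sub>R b1 \<theta> + t *\<^sub>R b2 \<theta>) x < e"
          using t by (intro bexI[of _ "s *\<^sub>R b1 \<theta> + t *\<^sub>R b2 \<theta>"]) (auto simp: fibre_def)
        obtain v where v: "\<bar>v - t\<bar> < e" "v \<notin> ?C" using out[OF \<open>0 < e\<close>] by blast
        have "dist (s *\<^sub>R b1 \<theta> + t *\<^sub>R b2 \<theta>) (s *\<^sub>R b1 \<theta> + v *\<^sub>R b2 \<theta>) < e"
          using v by (simp only: dist_fibre)
        then show "\<exists>x. x \<notin> K \<and> dist (s *\<^sub>R b1 \<theta> + t *\<^sub>R b2 \<theta>) x < e"
          using v by (auto simp: fibre_def)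
      qed
      have near: "v \<in> fibre \<theta> T s" if "\<bar>v - t\<bar> \<le> \<delta>" "s *\<^sub>R b1 \<theta> + t *\<^sub>R b2 \<theta> \<in> frontier K" for t v
        using that unfolding fibre_def T_def by (intro CollectI UN_I[OF that(2)]) (simp only: mem_cball dist_fibre)
      have "s *\<^sub>R b1 \<theta> + u *\<^sub>R b2 \<theta> \<in> frontier K"
      proof (rule fr[OF u(1)])
        fix e :: real assume "0 < e"
        then show "\<exists>v. \<bar>v - u\<bar> < e \<and> v \<notin> ?C"
          using u(2)[of "u + e / 2"] by (intro exI[of _ "u + e / 2"]) auto
      qed
      moreover have "s *\<^sub>R b1 \<theta> + l *\<^sub>R b2 \<theta> \<in> frontier K"
      proof (rule fr[OF l(1)])
        fix e :: real assume "0 < e"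
        then show "\<exists>v. \<bar>v - l\<bar> < e \<and> v \<notin> ?C"
          using l(2)[of "l - e / 2"] by (intro exI[of _ "l - e / 2"]) auto
      qed
      ultimately have fl: "s *\<^sub>R b1 \<theta> + u *\<^sub>R b2 \<theta> \<in> frontier K" "s *\<^sub>R b1 \<theta> + l *\<^sub>R b2 \<theta> \<in> frontier K"
        by blast+
      \<comment> \<open>The first interval is half-open so that the two stay disjoint when
        \<open>l + \<delta> = u - \<delta>\<close>.\<close>
      have sub: "{l-\<delta>..<l+\<delta>} \<union> {u-\<delta>..u+\<delta>} \<subseteq> fibre \<theta> T s"
      proof
        fix v assume "v \<in> {l-\<delta>..<l+\<delta>} \<union> {u-\<delta>..u+\<delta>}"
        then have "\<bar>v - l\<bar> \<le> \<delta> \<or> \<bar>v - u\<bar> \<le> \<delta>" by auto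
        then show "v \<in> fibre \<theta> T s" using near fl by blast
      qed
      have "ennreal (4 * \<delta>) = emeasure lborel {l-\<delta>..<l+\<delta>} + emeasure lborel {u-\<delta>..u+\<delta>}"
        using d by (simp flip: ennreal_plus)
      also have "\<dots> = emeasure lborel ({l-\<delta>..<l+\<delta>} \<union> {u-\<delta>..u+\<delta>})"
        using lu by (intro plus_emeasure) auto
      also have "\<dots> \<le> emeasure lborel (fibre \<theta> T s)"
        using sub by (rule emeasure_mono) (simp add: compact_fibre cT borel_compact)
      finally show ?thesis using True by simp
    qed simp
  qed
  also have "\<dots> = emeasure lborel T"
    by (rule emeasure_fibres[symmetric]) (use cT in \<open>auto simp: borel_compact compact_imp_bounded\<close>)
  finally have "ennreal (4 * \<delta> * measure lborel (fibres_of_length \<theta> K d)) \<le> ennreal (measure lborel T)"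
    using emeasure_compact_finite[OF cC] emeasure_compact_finite[OF cT] d
    by (simp add: emeasure_eq_ennreal_measure less_top ennreal_mult)
  then have "4 * \<delta> * measure lborel (fibres_of_length \<theta> K d) \<le> measure lborel T"
    by simp
  also have "measure lborel T = measure lebesgue T"
    using cT by (simp add: measure_completion borel_compact)
  finally show ?thesis by (simp add: T_def)
qed

text \<open>For fixed \<open>d\<close>, division of the neighbourhood bound by
  \<open>2 * \<epsilon>\<close> and the limit in \<epsilon> give twice the measure of the fibres of
  extent \<open>d\<close> as a lower bound for \<open>L\<close>. Only then does \<open>d\<close>
  tend to 0, by continuity of measure from below.\<close>

lemma wide_fibres_le_minkowski_content:
  assumes K: "compact K" and L: "has_minkowski_content (frontier K) L"
  shows "0 \<le> L" "emeasure lborel (wide_fibres \<theta> K) \<le> ennreal (L / 2)"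
proof -
  have ge: "2 * measure lborel (fibres_of_length \<theta> K d) \<le> L" if "0 < d" for d
  proof (rule tendsto_lowerbound)
    show "((\<lambda>\<epsilon>. measure lebesgue (\<Union>t\<in>frontier K. cball t \<epsilon>) / (2 * \<epsilon>)) \<longlongrightarrow> L) (at_right 0)"
      using L by (simp add: has_minkowski_content_def)
    show "\<forall>\<^sub>F \<epsilon> in at_right 0. 2 * measure lborel (fibres_of_length \<theta> K d)
        \<le> measure lebesgue (\<Union>t\<in>frontier K. cball t \<epsilon>) / (2 * \<epsilon>)"
      unfolding eventually_at_right_field
    proof (intro exI[of _ "d / 2"] conjI allI impI)
      fix \<epsilon> :: real assume "0 < \<epsilon>" "\<epsilon> < d / 2"
      with emeasure_neighbourhood_ge[OF K that, of \<epsilon> \<theta>]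
      show "2 * measure lborel (fibres_of_length \<theta> K d)
          \<le> measure lebesgue (\<Union>t\<in>frontier K. cball t \<epsilon>) / (2 * \<epsilon>)"
        by (simp add: field_simps)
    qed (use that in simp)
  qed simp
  have "0 \<le> 2 * measure lborel (fibres_of_length \<theta> K 1)" by simp
  also have "\<dots> \<le> L" by (rule ge) simp
  finally show "0 \<le> L" .
  have "emeasure lborel (wide_fibres \<theta> K) = (SUP k. emeasure lborel (fibres_of_length \<theta> K (1 / Suc k)))"
    unfolding wide_fibres_eq
  proof (rule SUP_emeasure_incseq[symmetric])
    show "range (\<lambda>k. fibres_of_length \<theta> K (1 / real (Suc k))) \<subseteq> sets lborel"
      using compact_fibres_of_length[OF K] by (auto intro: borel_compact)
    show "incseq (\<lambda>k. fibres_of_length \<theta> K (1 / real (Suc k)))"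
    proof (rule incseq_SucI)
      fix k
      have "1 / real (Suc (Suc k)) \<le> 1 / real (Suc k)" by (simp add: field_simps)
      then show "fibres_of_length \<theta> K (1 / real (Suc k)) \<subseteq> fibres_of_length \<theta> K (1 / real (Suc (Suc k)))"
        unfolding fibres_of_length_def using order_trans by blast
    qed
  qed
  also have "\<dots> \<le> ennreal (L / 2)"
  proof (rule SUP_least)
    fix k
    have "emeasure lborel (fibres_of_length \<theta> K (1 / Suc k)) = ennreal (measure lborel (fibres_of_length \<theta> K (1 / Suc k)))"
      using emeasure_compact_finite[OF compact_fibres_of_length[OF K]]
      by (simp add: emeasure_eq_ennreal_measure less_top)
    also have "\<dots> \<le> ennreal (L / 2)"
      using ge[of "1 / Suc k"] by (intro ennreal_leI) simp
    finally show "emeasure lborel (fibres_of_length \<theta> K (1 / Suc k)) \<le> ennreal (L / 2)" .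
  qed
  finally show "emeasure lborel (wide_fibres \<theta> K) \<le> ennreal (L / 2)" .
qed

text \<open>Only the two end points are tested; where the fibres of \<open>K\<close> are convex, the
  segment between them follows. Erosion by a square is obtained by eroding along both axes in
  turn.\<close>

definition erosion :: "real \<Rightarrow> real \<Rightarrow> (real^2) set \<Rightarrow> (real^2) set" where
  "erosion \<theta> e K = {p. p + e *\<^sub>R b2 \<theta> \<in> K \<and> p - e *\<^sub>R b2 \<theta> \<in> K}"

lemma compact_erosion:
  assumes "compact K"
  shows "compact (erosion \<theta> e K)"
proof -
  have "erosion \<theta> e K = (\<lambda>p. p - e *\<^sub>R b2 \<theta>) ` K \<inter> (\<lambda>p. p + e *\<^sub>R b2 \<theta>) ` K"
    by (force simp: erosion_def)
  also have "compact \<dots>"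
    using assms by (intro compact_Int compact_continuous_image continuous_intros)
  finally show ?thesis .
qed

text \<open>Each fibre is a compact interval and loses at most a piece of length \<open>e\<close> at
  each end, even if it is shorter than \<open>2 * e\<close>. Empty and one-point fibres lose nothing
  of positive length, so only wide fibres enter the integral.\<close>

lemma emeasure_diff_erosion_le:
  assumes K: "compact K" and conv: "\<And>s. convex (fibre \<theta> K s)" and e: "0 \<le> e"
  shows "emeasure lborel (K - erosion \<theta> e K) \<le> ennreal (2 * e) * emeasure lborel (wide_fibres \<theta> K)"
proof -
  have "emeasure lborel (K - erosion \<theta> e K) = (\<integral>\<^sup>+s. emeasure lborel (fibre \<theta> (K - erosion \<theta> e K) s) \<partial>lborel)"
    using K compact_erosion[OF K]
    by (intro emeasure_fibres sets.Diff borel_compact bounded_diff compact_imp_bounded)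
  also have "\<dots> \<le> (\<integral>\<^sup>+s. ennreal (2 * e) * indicator (wide_fibres \<theta> K) s \<partial>lborel)"
  proof (rule nn_integral_mono)
    fix s
    let ?C = "fibre \<theta> K s"
    have D: "fibre \<theta> (K - erosion \<theta> e K) s = ?C - {t. t + e \<in> ?C \<and> t - e \<in> ?C}"
      by (auto simp: fibre_def erosion_def algebra_simps)
    \<comment> \<open>An empty fibre is included as an interval with \<open>u < l\<close>; it falls
      under the second case below.\<close>
    obtain l u where C: "?C = {l..u}"
      using compact_fibre[OF K] conv convex_connected connected_compact_interval_1 by metis
    show "emeasure lborel (fibre \<theta> (K - erosion \<theta> e K) s) \<le> ennreal (2 * e) * indicator (wide_fibres \<theta> K) s"
    proof (cases "l < u")
      case True
      then have wide: "s \<in> wide_fibres \<theta> K"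
        unfolding wide_fibres_def mem_Collect_eq C by (intro bexI[of _ l] bexI[of _ u]) auto
      have "fibre \<theta> (K - erosion \<theta> e K) s \<subseteq> {l..l+e} \<union> {u-e..u}"
        using e unfolding D C by auto
      then have "emeasure lborel (fibre \<theta> (K - erosion \<theta> e K) s) \<le> emeasure lborel ({l..l+e} \<union> {u-e..u})"
        by (rule emeasure_mono) simp
      also have "\<dots> \<le> emeasure lborel {l..l+e} + emeasure lborel {u-e..u}"
        by (rule emeasure_subadditive) auto
      also have "\<dots> = ennreal (2 * e)"
        using e by (simp flip: ennreal_plus)
      finally show ?thesis using wide by simp
    next
      case False
      then have "fibre \<theta> (K - erosion \<theta> e K) s \<subseteq> {l}" unfolding D C by auto
      then have "emeasure lborel (fibre \<theta> (K - erosion \<theta> e K) s) \<le> emeasure lborel {l}"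
        by (rule emeasure_mono) simp
      then show ?thesis by simp
    qed
  qed
  also have "\<dots> = ennreal (2 * e) * emeasure lborel (wide_fibres \<theta> K)"
    using wide_fibres_measurable[OF K] by (simp add: nn_integral_cmult_indicator)
  finally show ?thesis .
qed

section \<open>Biconvexity of the hull and the area bound\<close>

lemma in_quad_trans: "in_quad \<theta> \<sigma> \<tau> p q \<Longrightarrow> in_quad \<theta> \<sigma> \<tau> q r \<Longrightarrow> in_quad \<theta> \<sigma> \<tau> p r"
  by (auto simp: in_quad_def inner_diff_right algebra_simps)

text \<open>On a segment parallel to an axis, every closed quadrant at \<open>r\<close> contains one
  of the two end points. A witness for that end point is then also one for \<open>r\<close>.\<close>

lemma biconvex_hull_segment:
  assumes A: "compact A" and pq: "p \<in> biconvex_hull \<theta> A" "q \<in> biconvex_hull \<theta> A"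
    and par: "b1 \<theta> \<bullet> (q - p) = 0 \<or> b2 \<theta> \<bullet> (q - p) = 0"
    and r: "r \<in> closed_segment p q"
  shows "r \<in> biconvex_hull \<theta> A"
  unfolding mem_biconvex_hull_iff_closed_quadrants[OF A]
proof (intro ballI)
  fix \<sigma> \<tau> assume st: "\<sigma> \<in> {1,-1::real}" "\<tau> \<in> {1,-1::real}"
  obtain w where w: "0 \<le> w" "w \<le> 1" "r = (1 - w) *\<^sub>R p + w *\<^sub>R q"
    using r by (auto simp: in_segment)
  then have "p - r = - w *\<^sub>R (q - p)" "q - r = (1 - w) *\<^sub>R (q - p)"
    by (simp_all add: algebra_simps)
  then have eqs: "b \<bullet> (p - r) = - w * (b \<bullet> (q - p))" "b \<bullet> (q - r) = (1 - w) * (b \<bullet> (q - p))" for b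
    by simp_all
  define a b where "a = \<sigma> * (b1 \<theta> \<bullet> (q - p))" and "b = \<tau> * (b2 \<theta> \<bullet> (q - p))"
  have quads: "in_quad \<theta> \<sigma> \<tau> r p \<longleftrightarrow> 0 \<le> - w * a \<and> 0 \<le> - w * b"
    "in_quad \<theta> \<sigma> \<tau> r q \<longleftrightarrow> 0 \<le> (1 - w) * a \<and> 0 \<le> (1 - w) * b"
    unfolding in_quad_def eqs a_def b_def by (simp_all only: mult.left_commute)
  have "a = 0 \<or> b = 0" using par by (auto simp: a_def b_def)
  then have "(0 \<le> a \<and> 0 \<le> b) \<or> (a \<le> 0 \<and> b \<le> 0)" by auto
  then have "in_quad \<theta> \<sigma> \<tau> r p \<or> in_quad \<theta> \<sigma> \<tau> r q"
  proof
    assume "0 \<le> a \<and> 0 \<le> b"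
    then show ?thesis unfolding quads using w(2) by (intro disjI2 conjI mult_nonneg_nonneg) auto
  next
    assume "a \<le> 0 \<and> b \<le> 0"
    then show ?thesis unfolding quads using w(1) by (intro disjI1 conjI mult_nonpos_nonpos) auto
  qed
  moreover have "\<exists>z\<in>A. in_quad \<theta> \<sigma> \<tau> p z" "\<exists>z\<in>A. in_quad \<theta> \<sigma> \<tau> q z"
    using pq st unfolding mem_biconvex_hull_iff_closed_quadrants[OF A] by blast+
  ultimately show "\<exists>z\<in>A. in_quad \<theta> \<sigma> \<tau> r z"
    using in_quad_trans by blast
qed

lemma convex_fibre_hull:
  assumes A: "compact A"
  shows "convex (fibre \<theta> (biconvex_hull \<theta> A) s)" "convex (fibre (\<theta> + pi / 2) (biconvex_hull \<theta> A) s)"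
proof -
  have seg: "s *\<^sub>R a + ((1 - w) * t + w * u) *\<^sub>R b \<in> closed_segment (s *\<^sub>R a + t *\<^sub>R b) (s *\<^sub>R a + u *\<^sub>R b)"
    if "0 \<le> w" "w \<le> 1" for w t u and a b :: "real^2"
    unfolding in_segment using that by (intro exI[of _ w]) (simp add: algebra_simps)
  have diff: "(s *\<^sub>R a + u *\<^sub>R b) - (s *\<^sub>R a + t *\<^sub>R b) = (u - t) *\<^sub>R b" for t u and a b :: "real^2"
    by (simp add: algebra_simps)
  have "convex {t. s *\<^sub>R a + t *\<^sub>R b \<in> biconvex_hull \<theta> A}"
    if "b1 \<theta> \<bullet> b = 0 \<or> b2 \<theta> \<bullet> b = 0" for a b
    unfolding convex_alt mem_Collect_eq
  proof (intro ballI allI impI, elim conjE CollectE)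
    fix t u w assume *: "s *\<^sub>R a + t *\<^sub>R b \<in> biconvex_hull \<theta> A" "s *\<^sub>R a + u *\<^sub>R b \<in> biconvex_hull \<theta> A"
      and w: "0 \<le> w" "w \<le> (1::real)"
    have "b1 \<theta> \<bullet> ((s *\<^sub>R a + u *\<^sub>R b) - (s *\<^sub>R a + t *\<^sub>R b)) = 0 \<or> b2 \<theta> \<bullet> ((s *\<^sub>R a + u *\<^sub>R b) - (s *\<^sub>R a + t *\<^sub>R b)) = 0"
      using that unfolding diff by auto
    then have "s *\<^sub>R a + ((1 - w) * t + w * u) *\<^sub>R b \<in> biconvex_hull \<theta> A"
      by (rule biconvex_hull_segment[OF A * _ seg[OF w]])
    then show "s *\<^sub>R a + ((1 - w) *\<^sub>R t + w *\<^sub>R u) *\<^sub>R b \<in> biconvex_hull \<theta> A" by simp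
  qed
  from this[of "b2 \<theta>" "b1 \<theta>"] this[of "- b1 \<theta>" "b2 \<theta>"]
  show "convex (fibre \<theta> (biconvex_hull \<theta> A) s)" "convex (fibre (\<theta> + pi / 2) (biconvex_hull \<theta> A) s)"
    unfolding fibre_def b1_shift b2_shift by simp_all
qed

text \<open>The points surviving erosion along both axes satisfy the corner criterion and so belong
  to the hull of \<open>X\<close>. Each erosion removes at most \<open>2 * ?d\<close> times
  \<open>L / 2\<close>, and the two losses add up to \<open>2 * L * ?d\<close>.\<close>

lemma measure_dist_hull_le:
  assumes S: "compact S" and X: "compact X" "X \<subseteq> S" "X \<noteq> {}"
    and L: "has_minkowski_content (frontier (biconvex_hull \<theta> S)) L"
  shows "measure_dist (biconvex_hull \<theta> X) (biconvex_hull \<theta> S) \<le> 2 * L * hausdorff_dist S X"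
proof -
  let ?S = "biconvex_hull \<theta> S" and ?X = "biconvex_hull \<theta> X" and ?d = "hausdorff_dist S X"
  define K1 where "K1 = erosion \<theta> ?d ?S"
  define K2 where "K2 = erosion (\<theta> + pi / 2) ?d K1"
  have nn: "0 \<le> ?d" using assms by (intro hausdorff_dist_nonneg) auto
  have cS: "compact ?S" using S by (rule compact_biconvex_hull)
  have c1: "compact K1" unfolding K1_def using cS by (rule compact_erosion)
  have c2: "compact K2" unfolding K2_def using c1 by (rule compact_erosion)
  have K1: "K1 \<subseteq> ?S"
  proof
    fix p assume p: "p \<in> K1"
    have "p \<in> closed_segment (p - ?d *\<^sub>R b2 \<theta>) (p + ?d *\<^sub>R b2 \<theta>)"
      using midpoint_in_closed_segment[of "p - ?d *\<^sub>R b2 \<theta>" "p + ?d *\<^sub>R b2 \<theta>"]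
      by (simp add: midpoint_def flip: scaleR_2)
    moreover have "p - ?d *\<^sub>R b2 \<theta> \<in> ?S" "p + ?d *\<^sub>R b2 \<theta> \<in> ?S"
      using p by (simp_all add: K1_def erosion_def)
    moreover have "b1 \<theta> \<bullet> (p + ?d *\<^sub>R b2 \<theta> - (p - ?d *\<^sub>R b2 \<theta>)) = 0"
      unfolding inner_diff_right inner_add_right inner_scaleR_right by simp
    ultimately show "p \<in> ?S"
      using biconvex_hull_segment[OF S] by blast
  qed
  have "?S - ?X \<subseteq> (?S - K1) \<union> (K1 - K2)"
  proof -
    have "p \<in> ?X" if "p \<in> K2" for p
    proof (rule mem_biconvex_hull_if_shifts[OF S X(1) sup_net_hausdorff_dist[OF S X(1,3)]])
      fix \<sigma> \<tau> assume "\<sigma> \<in> {1,-1::real}" "\<tau> \<in> {1,-1::real}"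
      moreover have "p + ?d *\<^sub>R b1 \<theta> + ?d *\<^sub>R b2 \<theta> \<in> ?S" "p + ?d *\<^sub>R b1 \<theta> - ?d *\<^sub>R b2 \<theta> \<in> ?S"
        "p - ?d *\<^sub>R b1 \<theta> + ?d *\<^sub>R b2 \<theta> \<in> ?S" "p - ?d *\<^sub>R b1 \<theta> - ?d *\<^sub>R b2 \<theta> \<in> ?S"
        using that by (simp_all add: K2_def K1_def erosion_def)
      ultimately show "p + ((\<sigma> * ?d) *\<^sub>R b1 \<theta> + (\<tau> * ?d) *\<^sub>R b2 \<theta>) \<in> ?S"
        unfolding add.assoc[symmetric] by auto
    qed
    then show ?thesis by blast
  qed
  moreover have "sym_diff ?X ?S = ?S - ?X" using biconvex_hull_mono[OF X(2), of \<theta>] by blast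
  ultimately have "sym_diff ?X ?S \<subseteq> (?S - K1) \<union> (K1 - K2)" by simp
  then have "emeasure lborel (sym_diff ?X ?S) \<le> emeasure lborel ((?S - K1) \<union> (K1 - K2))"
    by (rule emeasure_mono) (use cS c1 c2 in \<open>auto intro: borel_compact\<close>)
  also have "\<dots> \<le> emeasure lborel (?S - K1) + emeasure lborel (K1 - K2)"
    by (rule emeasure_subadditive) (use cS c1 c2 in \<open>auto intro: borel_compact\<close>)
  also have "\<dots> \<le> ennreal (L * ?d) + ennreal (L * ?d)"
  proof (rule add_mono)
    have half: "ennreal (2 * ?d) * m \<le> ennreal (L * ?d)" if "m \<le> ennreal (L / 2)" for m
    proof -
      have "ennreal (2 * ?d) * m \<le> ennreal (2 * ?d) * ennreal (L / 2)"
        using that by (rule mult_left_mono) simp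
      also have "\<dots> = ennreal (L * ?d)"
        using nn wide_fibres_le_minkowski_content(1)[OF cS L] by (simp add: mult.commute flip: ennreal_mult)
      finally show ?thesis .
    qed
    show "emeasure lborel (?S - K1) \<le> ennreal (L * ?d)"
      using emeasure_diff_erosion_le[OF cS convex_fibre_hull(1)[OF S] nn] half[OF wide_fibres_le_minkowski_content(2)[OF cS L]]
      unfolding K1_def by (rule order_trans)
    \<comment> \<open>Eroding along one axis turns a fibre along the other into the intersection of
      two fibres of the hull, which keeps it convex.\<close>
    have conv: "convex (fibre (\<theta> + pi / 2) K1 s)" for s
    proof -
      have "fibre (\<theta> + pi / 2) K1 s = fibre (\<theta> + pi / 2) ?S (s + ?d) \<inter> fibre (\<theta> + pi / 2) ?S (s - ?d)"
        by (auto simp: fibre_def K1_def erosion_def algebra_simps)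
      then show ?thesis using convex_fibre_hull(2)[OF S] by (simp add: convex_Int)
    qed
    \<comment> \<open>Wide fibres of the eroded set are wide for the hull as well, so the Minkowski
      content of the frontier of the hull controls the second erosion too.\<close>
    have "wide_fibres (\<theta> + pi / 2) K1 \<subseteq> wide_fibres (\<theta> + pi / 2) ?S"
      using K1 unfolding wide_fibres_def fibre_def by blast
    then have "emeasure lborel (wide_fibres (\<theta> + pi / 2) K1) \<le> emeasure lborel (wide_fibres (\<theta> + pi / 2) ?S)"
      using wide_fibres_measurable[OF cS] by (intro emeasure_mono) auto
    then have "emeasure lborel (wide_fibres (\<theta> + pi / 2) K1) \<le> ennreal (L / 2)"
      using wide_fibres_le_minkowski_content(2)[OF cS L] by (rule order_trans)
    then show "emeasure lborel (K1 - K2) \<le> ennreal (L * ?d)"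
      using emeasure_diff_erosion_le[OF c1 conv nn] half unfolding K2_def by (meson order_trans)
  qed
  also have "\<dots> = ennreal (2 * L * ?d)"
    using nn wide_fibres_le_minkowski_content(1)[OF cS L] by (simp flip: ennreal_plus)
  finally have "measure lborel (sym_diff ?X ?S) \<le> 2 * L * ?d"
    using nn wide_fibres_le_minkowski_content(1)[OF cS L] by (simp add: measure_def enn2real_leI)
  moreover have "sym_diff ?X ?S \<in> sets lborel"
    using cS compact_biconvex_hull[OF X(1)] by (auto intro: borel_compact)
  ultimately show ?thesis
    by (simp only: measure_dist_def measure_completion)
qed

subsection \<open>Random samples\<close>

text \<open>Suppose a hull point \<open>p\<close> is missing from \<open>S\<close>. On each axis
  line through \<open>p\<close> one of the two rays is then free of \<open>S\<close>. The two free
  rays bound a quadrant; \<open>S\<close> meets it and the opposite one but not its boundary,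
  contrary to connectedness.\<close>

lemma biconvex_hull_eq:
  assumes S: "compact S" "connected S" and bi: "biconvex \<theta> S"
  shows "biconvex_hull \<theta> S = S"
proof (intro subset_antisym subset_biconvex_hull subsetI, rule ccontr)
  fix p assume p: "p \<in> biconvex_hull \<theta> S" "p \<notin> S"
  have quad: "\<exists>s\<in>S. in_quad \<theta> \<sigma> \<tau> p s" if "\<sigma> \<in> {1,-1}" "\<tau> \<in> {1,-1}" for \<sigma> \<tau>
    using p(1) that unfolding mem_biconvex_hull_iff_closed_quadrants[OF S(1)] by blast
  \<comment> \<open>If both rays from \<open>p\<close> along \<open>b\<close> met \<open>S\<close>,
    convexity of the section would put \<open>p\<close> into \<open>S\<close>. The sign marks the
    free ray.\<close>
  have free_side: "\<exists>\<sigma>\<in>{1,-1::real}. \<forall>z\<in>S. b' \<bullet> (z - p) = 0 \<longrightarrow> \<sigma> * (b \<bullet> (z - p)) < 0"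
    if conv: "convex (range (\<lambda>t. t *\<^sub>R b + (b' \<bullet> p) *\<^sub>R b') \<inter> S)"
      and b: "b \<bullet> b = 1" "b \<bullet> b' = 0"
      and ex: "\<And>z. z = (b \<bullet> z) *\<^sub>R b + (b' \<bullet> z) *\<^sub>R b'" for b b' :: "real^2"
  proof (rule ccontr)
    assume neg: "\<not> ?thesis"
    let ?C = "range (\<lambda>t. t *\<^sub>R b + (b' \<bullet> p) *\<^sub>R b') \<inter> S"
    have mem: "b \<bullet> z \<in> (\<bullet>) b ` ?C" if "z \<in> S" "b' \<bullet> (z - p) = 0" for z
    proof -
      have "z = (b \<bullet> z) *\<^sub>R b + (b' \<bullet> p) *\<^sub>R b'"
        using ex[of z] that by (simp add: inner_diff_right)
      then show ?thesis using that by blast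
    qed
    obtain z w where zw: "z \<in> S" "b' \<bullet> (z - p) = 0" "0 \<le> b \<bullet> (z - p)"
      "w \<in> S" "b' \<bullet> (w - p) = 0" "b \<bullet> (w - p) \<le> 0"
      using neg by (auto simp: not_less)
    have "convex ((\<bullet>) b ` ?C)"
      using conv by (intro convex_linear_image) (simp_all add: bounded_linear_inner_right bounded_linear.linear)
    then have "is_interval ((\<bullet>) b ` ?C)" by (simp add: is_interval_convex_1)
    then have "b \<bullet> p \<in> (\<bullet>) b ` ?C"
      using mem[OF zw(1,2)] mem[OF zw(4,5)] zw(3,6) by (auto intro: mem_is_interval_1_I simp: inner_diff_right)
    then obtain t where "t *\<^sub>R b + (b' \<bullet> p) *\<^sub>R b' \<in> S" "b \<bullet> p = t"
      using b by (auto simp: inner_add_right)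
    then show False using p(2) ex[of p] by simp
  qed
  have "\<exists>\<sigma>\<in>{1,-1::real}. \<forall>z\<in>S. b2 \<theta> \<bullet> (z - p) = 0 \<longrightarrow> \<sigma> * (b1 \<theta> \<bullet> (z - p)) < 0"
    using bi unfolding biconvex_def by (intro free_side frame_expansion) simp_all
  then obtain \<sigma> where s: "\<sigma> \<in> {1,-1}" "\<And>z. z \<in> S \<Longrightarrow> b2 \<theta> \<bullet> (z - p) = 0 \<Longrightarrow> \<sigma> * (b1 \<theta> \<bullet> (z - p)) < 0"
    by blast
  have "\<exists>\<tau>\<in>{1,-1::real}. \<forall>z\<in>S. b1 \<theta> \<bullet> (z - p) = 0 \<longrightarrow> \<tau> * (b2 \<theta> \<bullet> (z - p)) < 0"
  proof (rule free_side)
    show "convex (range (\<lambda>t. t *\<^sub>R b2 \<theta> + (b1 \<theta> \<bullet> p) *\<^sub>R b1 \<theta>) \<inter> S)"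
      using bi unfolding biconvex_def add.commute[of "_ *\<^sub>R b2 \<theta>"] by blast
    show "z = (b2 \<theta> \<bullet> z) *\<^sub>R b2 \<theta> + (b1 \<theta> \<bullet> z) *\<^sub>R b1 \<theta>" for z
      by (subst add.commute) (rule frame_expansion)
  qed simp_all
  then obtain \<tau> where t: "\<tau> \<in> {1,-1}" "\<And>z. z \<in> S \<Longrightarrow> b1 \<theta> \<bullet> (z - p) = 0 \<Longrightarrow> \<tau> * (b2 \<theta> \<bullet> (z - p)) < 0"
    by blast
  \<comment> \<open>The closed quadrant \<open>(\<sigma>, \<tau>)\<close> at \<open>p\<close> now meets \<open>S\<close> only in its interior, so it splits \<open>S\<close>.\<close>
  let ?A = "{z. 0 \<le> \<sigma> * (b1 \<theta> \<bullet> (z - p))} \<inter> {z. 0 \<le> \<tau> * (b2 \<theta> \<bullet> (z - p))}"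
  let ?B = "{z. \<sigma> * (b1 \<theta> \<bullet> (z - p)) \<le> 0} \<union> {z. \<tau> * (b2 \<theta> \<bullet> (z - p)) \<le> 0}"
  have "closed ?A" "closed ?B"
    by (intro closed_Int closed_Un closed_Collect_le continuous_intros)+
  moreover have "?A \<inter> ?B \<inter> S = {}"
  proof (intro equals0I, elim IntE UnE CollectE)
    fix z assume z: "z \<in> S" "0 \<le> \<sigma> * (b1 \<theta> \<bullet> (z - p))" "0 \<le> \<tau> * (b2 \<theta> \<bullet> (z - p))"
    show False if "\<sigma> * (b1 \<theta> \<bullet> (z - p)) \<le> 0"
    proof -
      have "b1 \<theta> \<bullet> (z - p) = 0" using that z s(1) by auto
      then show False using t(2)[OF z(1)] z(3) by simp
    qed
    show False if "\<tau> * (b2 \<theta> \<bullet> (z - p)) \<le> 0"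
    proof -
      have "b2 \<theta> \<bullet> (z - p) = 0" using that z t(1) by auto
      then show False using s(2)[OF z(1)] z(2) by simp
    qed
  qed
  moreover have "S \<subseteq> ?A \<union> ?B" by auto
  moreover have "?A \<inter> S \<noteq> {}"
    using quad[OF s(1) t(1)] by (auto simp: in_quad_def)
  moreover have "?B \<inter> S \<noteq> {}"
  proof -
    have "- \<sigma> \<in> {1,-1}" "- \<tau> \<in> {1,-1}" using s t by auto
    then obtain z where "z \<in> S" "in_quad \<theta> (-\<sigma>) (-\<tau>) p z" using quad by blast
    then show ?thesis by (auto simp: in_quad_def)
  qed
  ultimately show False
    using connected_closedD[OF S(2), of ?A ?B] by blast
qed

section \<open>Almost sure convergence of samples to the support\<close>

lemma is_support_nonempty: "is_support P S \<Longrightarrow> S \<noteq> {}"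
  unfolding is_support_def using measure_empty zero_neq_one by metis

text \<open>Otherwise the complement of the ball would be a closed set of probability one, and
  minimality of the support would exclude \<open>x\<close>.\<close>

lemma support_ball_pos:
  assumes P: "prob_space P" "sets P = sets borel" and S: "is_support P S" and x: "x \<in> S" "0 < e"
  shows "0 < measure P (ball x e)"
proof (rule ccontr)
  interpret P: prob_space P by fact
  assume "\<not> 0 < measure P (ball x e)"
  then have "measure P (ball x e) = 0"
    using measure_nonneg[of P "ball x e"] by linarith
  then have "measure P (space P - ball x e) = 1"
    using P.prob_compl[of "ball x e"] P(2) by simp
  moreover have "space P = UNIV" using sets_eq_imp_space_eq[OF P(2)] by simp
  ultimately have "measure P (- ball x e) = 1" by (simp add: Compl_eq_Diff_UNIV)
  moreover have "closed (- ball x e)" by (simp add: closed_Compl)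
  ultimately have "S \<subseteq> - ball x e" using S by (auto simp: is_support_def)
  then show False using x by auto
qed

text \<open>Two points in a common ball of radius \<open>e / 2\<close> are less than
  \<open>e\<close> apart. With a finite cover this reduces convergence to finitely many events of
  the kind that the sample hits a given ball.\<close>

lemma hausdorff_dist_le_of_hits:
  assumes X: "X \<subseteq> S" "S \<noteq> {}" and cover: "S \<subseteq> (\<Union>t\<in>T. ball t (e / 2))"
    and hit: "\<And>t. t \<in> T \<Longrightarrow> \<exists>x\<in>X. x \<in> ball t (e / 2)" and e: "0 \<le> e"
  shows "hausdorff_dist S X \<le> e"
proof (rule hausdorff_dist_le)
  have near: "\<exists>x\<in>X. dist s x \<le> e" if "s \<in> S" for s
  proof -
    have "s \<in> (\<Union>t\<in>T. ball t (e / 2))" using that cover by blast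
    then obtain t where t: "t \<in> T" "dist t s < e / 2" by auto
    obtain x where "x \<in> X" "dist t x < e / 2" using hit[OF t(1)] by auto
    with t(2) have "dist s x < e" by (metis dist_commute dist_triangle_half_r)
    then show ?thesis using \<open>x \<in> X\<close> less_imp_le by blast
  qed
  then show "X \<noteq> {}" using X(2) by blast
  show "infdist a X \<le> e" if "a \<in> S" for a
    using near[OF that] infdist_le2 by blast
  show "infdist c S \<le> e" if "c \<in> X" for c
    using that X(1) e by (intro infdist_le2[of c]) auto
qed (fact X(2))

text \<open>A sample of size \<open>n\<close> misses \<open>B\<close> with probability
  \<open>q ^ n\<close>, and these numbers are summable. The samples for different \<open>n\<close>
  may depend on each other arbitrarily, which the first Borel-Cantelli lemma allows.\<close>

lemma AE_sample_hits_ball: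
  assumes M: "prob_space M" and P: "prob_space P" "sets P = sets borel"
    and iid: "\<And>n. 1 \<le> n \<Longrightarrow> iid_sample M P n (Y n)"
    and B: "B \<in> sets borel" "0 < measure P B"
  shows "AE \<omega> in M. \<forall>\<^sub>F n in sequentially. \<exists>x\<in>sample_set n (Y n) \<omega>. x \<in> B"
proof -
  interpret M: prob_space M by fact
  interpret P: prob_space P by fact
  have space: "space P = UNIV" using sets_eq_imp_space_eq[OF P(2)] by simp
  define q where "q = measure P (- B)"
  have q: "0 \<le> q" "q < 1"
    using P.prob_compl[of B] B P(2) space by (simp_all add: q_def Compl_eq_Diff_UNIV)
  \<comment> \<open>The value at 0 is set separately: the intersection over an empty index set would
    be the whole type, and \<open>iid\<close> speaks only of positive sizes.\<close>
  define A where "A n = (if n = 0 then {} else (\<Inter>i\<in>{1..n}. Y n i -` (- B) \<inter> space M))" for n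
  have rv: "Y n i \<in> borel_measurable M" if "i \<in> {1..n}" for n i
    using iid[of n] that by (auto simp: iid_sample_def M.indep_vars_def)
  have A_sets: "A n \<in> sets M" for n
  proof (cases "n = 0")
    case False
    then show ?thesis
      unfolding A_def using B(1)
      by (auto intro!: sets.finite_INT measurable_sets[OF rv] simp del: INT_simps)
  qed (simp add: A_def)
  have A_prob: "measure M (A n) \<le> q ^ n" for n
  proof (cases "n = 0")
    case False
    have "M.indep_vars (\<lambda>_. borel) (Y n) {1..n}"
      using False iid[of n] by (simp add: iid_sample_def)
    then have "measure M (\<Inter>i\<in>{1..n}. Y n i -` (- B) \<inter> space M) = (\<Prod>i\<in>{1..n}. measure M (Y n i -` (- B) \<inter> space M))"
      by (rule M.indep_varsD) (use False B(1) in auto)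
    then have "measure M (A n) = (\<Prod>i\<in>{1..n}. measure M (Y n i -` (- B) \<inter> space M))"
      using False by (simp only: A_def if_False)
    also have "\<dots> = (\<Prod>i\<in>{1..n}. q)"
    proof (rule prod.cong)
      fix i assume i: "i \<in> {1..n}"
      then have "distr M borel (Y n i) = P" using iid[of n] by (auto simp: iid_sample_def)
      moreover have "measure (distr M borel (Y n i)) (- B) = measure M (Y n i -` (- B) \<inter> space M)"
        using B(1) by (intro measure_distr rv i) auto
      ultimately show "measure M (Y n i -` (- B) \<inter> space M) = q" by (simp add: q_def)
    qed simp
    finally show ?thesis by simp
  qed (simp add: A_def)
  have "summable (\<lambda>n. measure M (A n))"
    by (rule summable_comparison_test'[of "\<lambda>n. q ^ n" 0]) (use A_prob q in \<open>auto intro: summable_geometric\<close>)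
  then have "AE \<omega> in M. \<forall>\<^sub>F n in sequentially. \<omega> \<in> space M - A n"
    using A_sets by (intro borel_cantelli_AE1) (auto simp: M.emeasure_eq_measure)
  then show ?thesis
  proof eventually_elim
    case (elim \<omega>)
    with eventually_gt_at_top[of 0] show ?case
      by eventually_elim (auto simp: A_def sample_set_def)
  qed
qed

text \<open>Compactness gives a finite cover by balls centred in the support for each accuracy
  \<open>1 / Suc k\<close>. Countably many accuracies suffice, so the exceptional events combine to
  a null set.\<close>

lemma AE_sample_hausdorff_dist_tendsto:
  assumes M: "prob_space M" and P: "prob_space P" "sets P = sets borel"
    and iid: "\<And>n. 1 \<le> n \<Longrightarrow> iid_sample M P n (Y n)"
    and S: "compact S" "is_support P S"
  shows "AE \<omega> in M. (\<forall>n. sample_set n (Y n) \<omega> \<subseteq> S) \<and> (\<lambda>n. hausdorff_dist S (sample_set n (Y n) \<omega>)) \<longlonglongrightarrow> 0"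
proof -
  interpret M: prob_space M by fact
  interpret P: prob_space P by fact
  have "S \<noteq> {}" using S(2) by (rule is_support_nonempty)
  have inS: "AE \<omega> in M. \<forall>n. sample_set n (Y n) \<omega> \<subseteq> S"
  proof -
    have "AE \<omega> in M. Y n i \<omega> \<in> S" if i: "i \<in> {1..n}" for n i
    proof -
      have "1 \<le> n" using i by simp
      then have d: "distr M borel (Y n i) = P" and rv: "Y n i \<in> borel_measurable M"
        using iid[of n] i by (auto simp: iid_sample_def M.indep_vars_def)
      have "AE x in P. x \<in> S"
        using S P(2) by (subst P.AE_in_set_eq_1) (auto simp: is_support_def)
      then have "AE x in distr M borel (Y n i). x \<in> S" by (simp only: d)
      then show ?thesis by (rule AE_distrD[OF rv])
    qed
    then have "AE \<omega> in M. \<forall>i\<in>{1..n}. Y n i \<omega> \<in> S" for n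
      by (intro AE_finite_allI) auto
    then have "AE \<omega> in M. \<forall>n. \<forall>i\<in>{1..n}. Y n i \<omega> \<in> S"
      by (simp add: AE_all_countable)
    then show ?thesis by eventually_elim (auto simp: sample_set_def)
  qed
  have "AE \<omega> in M. \<forall>\<^sub>F n in sequentially. hausdorff_dist S (sample_set n (Y n) \<omega>) \<le> 1 / Suc k" for k
  proof -
    define e where "e = 1 / real (Suc k)"
    have e: "0 < e" by (simp add: e_def)
    obtain T where T: "T \<subseteq> S" "finite T" "S \<subseteq> (\<Union>t\<in>T. ball t (e / 2))"
      by (rule compactE_image[OF S(1), of S "\<lambda>t. ball t (e / 2)"]) (use e in auto)
    have "AE \<omega> in M. \<forall>t\<in>T. \<forall>\<^sub>F n in sequentially. \<exists>x\<in>sample_set n (Y n) \<omega>. x \<in> ball t (e / 2)"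
    proof (rule AE_finite_allI[OF T(2)])
      fix t assume "t \<in> T"
      then have "0 < measure P (ball t (e / 2))"
        using T(1) e by (intro support_ball_pos[OF P S(2)]) auto
      then show "AE \<omega> in M. \<forall>\<^sub>F n in sequentially. \<exists>x\<in>sample_set n (Y n) \<omega>. x \<in> ball t (e / 2)"
        by (intro AE_sample_hits_ball[OF M P iid]) auto
    qed
    with inS show ?thesis
    proof eventually_elim
      case (elim \<omega>)
      then have "\<forall>\<^sub>F n in sequentially. \<forall>t\<in>T. \<exists>x\<in>sample_set n (Y n) \<omega>. x \<in> ball t (e / 2)"
        using T(2) by (simp add: eventually_ball_finite)
      then show ?case
        using hausdorff_dist_le_of_hits[OF _ \<open>S \<noteq> {}\<close> T(3)] elim(1) e
        unfolding e_def[symmetric] by (auto elim!: eventually_mono)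
    qed
  qed
  then have "AE \<omega> in M. \<forall>k. \<forall>\<^sub>F n in sequentially. hausdorff_dist S (sample_set n (Y n) \<omega>) \<le> 1 / Suc k"
    by (simp add: AE_all_countable)
  with inS show ?thesis
  proof eventually_elim
    case (elim \<omega>)
    have "(\<lambda>n. hausdorff_dist S (sample_set n (Y n) \<omega>)) \<longlonglongrightarrow> 0"
      unfolding tendsto_iff
    proof (intro allI impI)
      fix e :: real assume "0 < e"
      then obtain k where k: "1 / real (Suc k) < e"
        using reals_Archimedean[of e] by (auto simp: inverse_eq_divide)
      have nn: "0 \<le> hausdorff_dist S X" for X
        using S(1) \<open>S \<noteq> {}\<close> by (rule hausdorff_dist_nonneg)
      have "\<forall>\<^sub>F n in sequentially. hausdorff_dist S (sample_set n (Y n) \<omega>) \<le> 1 / Suc k"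
        using elim(2) by blast
      then show "\<forall>\<^sub>F n in sequentially. dist (hausdorff_dist S (sample_set n (Y n) \<omega>)) 0 < e"
        by eventually_elim (use k nn in \<open>auto simp: dist_real_def\<close>)
    qed
    with elim(1) show ?case by blast
  qed
qed

section \<open>Consistency of the estimators\<close>

lemma hausdorff_dist_commute: "hausdorff_dist A C = hausdorff_dist C A"
  by (simp add: hausdorff_dist_def max.commute)

lemma biconvex_hull_estimators_tendsto:
  assumes S: "compact S" "connected S" "biconvex \<theta> S" "S \<noteq> {}"
    and X: "\<And>n. X n \<subseteq> S" "\<forall>\<^sub>F n in sequentially. compact (X n) \<and> X n \<noteq> {}"
    and lim: "(\<lambda>n. hausdorff_dist S (X n)) \<longlonglongrightarrow> 0"
  shows "(\<lambda>n. hausdorff_dist (biconvex_hull \<theta> (X n)) S) \<longlonglongrightarrow> 0"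
    and "(\<lambda>n. hausdorff_dist (frontier (biconvex_hull \<theta> (X n))) (frontier S)) \<longlonglongrightarrow> 0"
    and "has_minkowski_content (frontier S) L \<Longrightarrow> (\<lambda>n. measure_dist (biconvex_hull \<theta> (X n)) S) \<longlonglongrightarrow> 0"
proof -
  note eq = biconvex_hull_eq[OF S(1-3)]
  have lim': "(\<lambda>n. c * hausdorff_dist S (X n)) \<longlonglongrightarrow> 0" for c
    using tendsto_mult_right_zero[OF lim] .
  show "(\<lambda>n. hausdorff_dist (biconvex_hull \<theta> (X n)) S) \<longlonglongrightarrow> 0"
  proof (rule tendsto_sandwich[OF _ _ tendsto_const lim'])
    show "\<forall>\<^sub>F n in sequentially. 0 \<le> hausdorff_dist (biconvex_hull \<theta> (X n)) S"
      by (subst hausdorff_dist_commute) (simp add: hausdorff_dist_nonneg S)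
    show "\<forall>\<^sub>F n in sequentially. hausdorff_dist (biconvex_hull \<theta> (X n)) S \<le> sqrt 2 * hausdorff_dist S (X n)"
      using X(2) by eventually_elim (metis hausdorff_dist_hull_le S(1,2) X(1) eq)
  qed
  show "(\<lambda>n. hausdorff_dist (frontier (biconvex_hull \<theta> (X n))) (frontier S)) \<longlonglongrightarrow> 0"
  proof (rule tendsto_sandwich[OF _ _ tendsto_const lim'])
    show "\<forall>\<^sub>F n in sequentially. 0 \<le> hausdorff_dist (frontier (biconvex_hull \<theta> (X n))) (frontier S)"
      by (subst hausdorff_dist_commute) (simp add: hausdorff_dist_nonneg compact_frontier frontier_nonempty_compact S)
    show "\<forall>\<^sub>F n in sequentially. hausdorff_dist (frontier (biconvex_hull \<theta> (X n))) (frontier S)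
        \<le> sqrt 2 * hausdorff_dist S (X n)"
      using X(2) by eventually_elim (metis hausdorff_dist_frontier_hull_le hausdorff_dist_commute S(1,2) X(1) eq)
  qed
  assume L: "has_minkowski_content (frontier S) L"
  show "(\<lambda>n. measure_dist (biconvex_hull \<theta> (X n)) S) \<longlonglongrightarrow> 0"
  proof (rule tendsto_sandwich[OF _ _ tendsto_const lim'])
    show "\<forall>\<^sub>F n in sequentially. 0 \<le> measure_dist (biconvex_hull \<theta> (X n)) S"
      by (simp add: measure_dist_def)
    show "\<forall>\<^sub>F n in sequentially. measure_dist (biconvex_hull \<theta> (X n)) S \<le> (2 * L) * hausdorff_dist S (X n)"
      using X(2) by eventually_elim (metis measure_dist_hull_le S(1) X(1) eq L)
  qed
qed

theorem theorem4:
  fixes S :: "(real^2) set"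
  assumes "compact S"
    and "path_connected (frontier S)"
    and "S = closure (interior S)"
  shows
    "(\<forall>X :: nat \<Rightarrow> (real^2) set. (\<forall>n\<ge>1. X n \<subseteq> S \<and> card (X n) = n) \<longrightarrow>
        (\<forall>\<theta>\<in>{0..<pi/2}. \<forall>n\<ge>1. \<forall>c>sqrt 2.
           hausdorff_dist (biconvex_hull \<theta> (X n)) (biconvex_hull \<theta> S)
             \<le> c * hausdorff_dist S (X n) \<and>
           hausdorff_dist (frontier (biconvex_hull \<theta> S)) (frontier (biconvex_hull \<theta> (X n)))
             \<le> c * hausdorff_dist S (X n)) \<and>
        (\<forall>L0 :: real \<Rightarrow> real.
           (\<forall>\<theta>\<in>{0..<pi/2}. has_minkowski_content (frontier (biconvex_hull \<theta> S)) (L0 \<theta>)) \<longrightarrow>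
           (\<forall>\<theta>\<in>{0..<pi/2}. \<forall>c>sqrt 2. \<forall>\<^sub>F n in sequentially.
              measure_dist (biconvex_hull \<theta> (X n)) (biconvex_hull \<theta> S)
                \<le> 2 * c * L0 \<theta> * hausdorff_dist S (X n))))
     \<and>
     (\<forall>\<theta>\<in>{0..<pi/2}. \<forall>(M :: 'w measure) (P :: (real^2) measure)
         (Y :: nat \<Rightarrow> nat \<Rightarrow> 'w \<Rightarrow> real^2).
        prob_space M \<and> prob_space P \<and> sets P = sets borel \<and>
        is_support P S \<and> biconvex \<theta> S \<and> (\<forall>n\<ge>1. iid_sample M P n (Y n)) \<longrightarrow>
        (AE \<omega> in M.
           (\<lambda>n. hausdorff_dist (biconvex_hull \<theta> (sample_set n (Y n) \<omega>)) S) \<longlonglongrightarrow> 0) \<and>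
        (AE \<omega> in M.
           (\<lambda>n. hausdorff_dist (frontier (biconvex_hull \<theta> (sample_set n (Y n) \<omega>))) (frontier S))
             \<longlonglongrightarrow> 0) \<and>
        ((\<forall>\<theta>'\<in>{0..<pi/2}. \<exists>L. has_minkowski_content (frontier (biconvex_hull \<theta>' S)) L) \<longrightarrow>
         (AE \<omega> in M.
            (\<lambda>n. measure_dist (biconvex_hull \<theta> (sample_set n (Y n) \<omega>)) S) \<longlonglongrightarrow> 0)))"
proof (intro conjI allI impI ballI)
  have conn: "connected S"
    using connected_if_connected_frontier[OF assms(1) path_connected_imp_connected[OF assms(2)]] .
  show "hausdorff_dist (biconvex_hull \<theta> (X n)) (biconvex_hull \<theta> S) \<le> c * hausdorff_dist S (X n)"
    "hausdorff_dist (frontier (biconvex_hull \<theta> S)) (frontier (biconvex_hull \<theta> (X n))) \<le> c * hausdorff_dist S (X n)"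
    if X: "\<forall>n\<ge>1. X n \<subseteq> S \<and> card (X n) = n" and n: "1 \<le> n" and c: "sqrt 2 < c"
    for X :: "nat \<Rightarrow> (real^2) set" and \<theta> n c
  proof -
    \<comment> \<open>A positive cardinality makes the set finite and nonempty, because
      \<open>card\<close> is 0 on infinite sets.\<close>
    have Xn: "compact (X n)" "X n \<subseteq> S" "X n \<noteq> {}"
      using X n by (auto intro!: finite_imp_compact card_ge_0_finite)
    have "sqrt 2 * hausdorff_dist S (X n) \<le> c * hausdorff_dist S (X n)"
      using c Xn assms(1) by (intro mult_right_mono hausdorff_dist_nonneg) auto
    then show "hausdorff_dist (biconvex_hull \<theta> (X n)) (biconvex_hull \<theta> S) \<le> c * hausdorff_dist S (X n)"
      "hausdorff_dist (frontier (biconvex_hull \<theta> S)) (frontier (biconvex_hull \<theta> (X n))) \<le> c * hausdorff_dist S (X n)"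
      using hausdorff_dist_hull_le[OF assms(1) conn Xn, of \<theta>]
        hausdorff_dist_frontier_hull_le[OF assms(1) conn Xn, of \<theta>] by linarith+
  qed
  show "\<forall>\<^sub>F n in sequentially. measure_dist (biconvex_hull \<theta> (X n)) (biconvex_hull \<theta> S)
      \<le> 2 * c * L0 \<theta> * hausdorff_dist S (X n)"
    if X: "\<forall>n\<ge>1. X n \<subseteq> S \<and> card (X n) = n" and \<theta>: "\<theta> \<in> {0..<pi/2}" and c: "sqrt 2 < c"
      and L: "\<forall>\<theta>\<in>{0..<pi/2}. has_minkowski_content (frontier (biconvex_hull \<theta> S)) (L0 \<theta>)"
    for X :: "nat \<Rightarrow> (real^2) set" and \<theta> c and L0 :: "real \<Rightarrow> real"
    using eventually_ge_at_top[of 1]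
  proof eventually_elim
    case (elim n)
    have Xn: "compact (X n)" "X n \<subseteq> S" "X n \<noteq> {}"
      using X elim by (auto intro!: finite_imp_compact card_ge_0_finite)
    have L\<theta>: "has_minkowski_content (frontier (biconvex_hull \<theta> S)) (L0 \<theta>)" using L \<theta> by blast
    have "0 \<le> L0 \<theta> * hausdorff_dist S (X n)"
      using assms(1) Xn wide_fibres_le_minkowski_content(1)[OF compact_biconvex_hull[OF assms(1)] L\<theta>]
      by (intro mult_nonneg_nonneg hausdorff_dist_nonneg) auto
    \<comment> \<open>The area bound holds with constant \<open>2 * L0 \<theta>\<close>; as this
      times the distance is nonnegative, the factor \<open>c\<close> only enlarges it.\<close>
    moreover have "1 \<le> c" using c real_sqrt_ge_one[of 2] by linarith
    ultimately have "1 * (L0 \<theta> * hausdorff_dist S (X n)) \<le> c * (L0 \<theta> * hausdorff_dist S (X n))"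
      by (intro mult_right_mono)
    then show ?case
      using measure_dist_hull_le[OF assms(1) Xn L\<theta>] by (simp add: mult.assoc)
  qed
  \<comment> \<open>All three limits are obtained on one almost sure event, where the samples lie in
    \<open>S\<close> and approach it.\<close>
  have sample: "AE \<omega> in M.
      (\<lambda>n. hausdorff_dist (biconvex_hull \<theta> (sample_set n (Y n) \<omega>)) S) \<longlonglongrightarrow> 0 \<and>
      (\<lambda>n. hausdorff_dist (frontier (biconvex_hull \<theta> (sample_set n (Y n) \<omega>))) (frontier S)) \<longlonglongrightarrow> 0 \<and>
      ((\<exists>L. has_minkowski_content (frontier S) L) \<longrightarrow>
        (\<lambda>n. measure_dist (biconvex_hull \<theta> (sample_set n (Y n) \<omega>)) S) \<longlonglongrightarrow> 0)"
    if *: "prob_space M \<and> prob_space P \<and> sets P = sets borel \<and> is_support P S \<and> biconvex \<theta> S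
      \<and> (\<forall>n\<ge>1. iid_sample M P n (Y n))"
    for \<theta> and M :: "'w measure" and P and Y :: "nat \<Rightarrow> nat \<Rightarrow> 'w \<Rightarrow> real^2"
  proof -
    have "AE \<omega> in M. (\<forall>n. sample_set n (Y n) \<omega> \<subseteq> S) \<and> (\<lambda>n. hausdorff_dist S (sample_set n (Y n) \<omega>)) \<longlonglongrightarrow> 0"
      by (rule AE_sample_hausdorff_dist_tendsto[of M P]) (use * assms(1) in auto)
    then show ?thesis
    proof eventually_elim
      case (elim \<omega>)
      have "S \<noteq> {}" using * is_support_nonempty by blast
      moreover have "\<forall>\<^sub>F n in sequentially. compact (sample_set n (Y n) \<omega>) \<and> sample_set n (Y n) \<omega> \<noteq> {}"
        using eventually_ge_at_top[of 1]
        by eventually_elim (auto simp: sample_set_def intro: finite_imp_compact)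
      ultimately show ?case
        using elim * biconvex_hull_estimators_tendsto[OF assms(1) conn, of \<theta> "\<lambda>n. sample_set n (Y n) \<omega>"] by blast
    qed
  qed
  show "AE \<omega> in M. (\<lambda>n. hausdorff_dist (biconvex_hull \<theta> (sample_set n (Y n) \<omega>)) S) \<longlonglongrightarrow> 0"
    "AE \<omega> in M. (\<lambda>n. hausdorff_dist (frontier (biconvex_hull \<theta> (sample_set n (Y n) \<omega>))) (frontier S)) \<longlonglongrightarrow> 0"
    if *: "prob_space M \<and> prob_space P \<and> sets P = sets borel \<and> is_support P S \<and> biconvex \<theta> S
      \<and> (\<forall>n\<ge>1. iid_sample M P n (Y n))"
    for \<theta> and M :: "'w measure" and P and Y :: "nat \<Rightarrow> nat \<Rightarrow> 'w \<Rightarrow> real^2"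
    using sample[OF *] by (auto elim: eventually_mono)
  show "AE \<omega> in M. (\<lambda>n. measure_dist (biconvex_hull \<theta> (sample_set n (Y n) \<omega>)) S) \<longlonglongrightarrow> 0"
    if \<theta>: "\<theta> \<in> {0..<pi/2}"
      and *: "prob_space M \<and> prob_space P \<and> sets P = sets borel \<and> is_support P S \<and> biconvex \<theta> S
        \<and> (\<forall>n\<ge>1. iid_sample M P n (Y n))"
      and L: "\<forall>\<theta>'\<in>{0..<pi/2}. \<exists>L. has_minkowski_content (frontier (biconvex_hull \<theta>' S)) L"
    for \<theta> and M :: "'w measure" and P and Y :: "nat \<Rightarrow> nat \<Rightarrow> 'w \<Rightarrow> real^2"
  proof -
    \<comment> \<open>For the angle at hand the hull of \<open>S\<close> is \<open>S\<close> itself,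
      so the content assumption applies to the frontier of \<open>S\<close>.\<close>
    have "\<exists>L. has_minkowski_content (frontier S) L"
      using L \<theta> * biconvex_hull_eq[OF assms(1) conn] by metis
    then show ?thesis using sample[OF *] by (auto elim: eventually_mono)
  qed
qed

end
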